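(* Let $g\ge 1$ be an integer and let $G$ be a planar graph with girth at least $8g$. Then the circular chromatic number of $G$ is at most $2+\frac{1}{g}$.
   Context: All graphs are finite and simple. The girth of a graph is the length of a shortest cycle (infinite if there is none). The circular chromatic number of $G$ is the infimum of the rationals $p/q$ (with $p\ge 2q$, $q\ge1$) such that there is a map $c:V(G)\to\{0,1,\ldots,p-1\}$ with $q\le |c(u)-c(v)|\le p-q$ for every edge $uv$ of $G$. In particular, it is known that it is at most $2+\frac1g$ if and only if $G$ admits a homomorphism to the cycle $C_{2g+1}$ on $2g+1$ vertices. *)

theory Defs
  imports "HOL-Analysis.Analysis" "HOL-Library.Extended_Nat" "HOL-Library.FuncSet"
begin

definition simple_graph :: "'a set \<Rightarrow> 'a set set \<Rightarrow> bool" where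
  "simple_graph V E \<longleftrightarrow> finite V \<and> (\<forall>e\<in>E. e \<subseteq> V \<and> card e = 2)"

text \<open>A cycle is given by the list of its vertices in cyclic order; the last vertex is
  joined back to the first one.\<close>

definition is_cycle :: "'a set set \<Rightarrow> 'a list \<Rightarrow> bool" where
  "is_cycle E vs \<longleftrightarrow> 3 \<le> length vs \<and> distinct vs \<and>
     (\<forall>i<length vs. {vs ! i, vs ! (Suc i mod length vs)} \<in> E)"

text \<open>The infimum of the empty set in \<^typ>\<open>enat\<close> is \<open>\<infinity>\<close>, so forests have infinite girth.\<close>

definition girth :: "'a set set \<Rightarrow> enat" where
  "girth E = (INF vs\<in>{vs. is_cycle E vs}. enat (length vs))"

text \<open>A drawing in the Euclidean plane, which is represented by \<^typ>\<open>complex\<close>: vertices are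
  distinct points, and edges are arcs (injective continuous images of the unit interval) that
  join their end vertices, pass through no other vertex, and meet each other only in
  vertices.\<close>

definition plane_drawing ::
    "'a set \<Rightarrow> 'a set set \<Rightarrow> ('a \<Rightarrow> complex) \<Rightarrow> ('a set \<Rightarrow> real \<Rightarrow> complex) \<Rightarrow> bool" where
  "plane_drawing V E pos \<gamma> \<longleftrightarrow>
     inj_on pos V \<and>
     (\<forall>e\<in>E. arc (\<gamma> e) \<and> {pathstart (\<gamma> e), pathfinish (\<gamma> e)} = pos ` e \<and>
             path_image (\<gamma> e) \<inter> pos ` V = pos ` e) \<and>
     (\<forall>e\<in>E. \<forall>f\<in>E. e \<noteq> f \<longrightarrow> path_image (\<gamma> e) \<inter> path_image (\<gamma> f) \<subseteq> pos ` V)"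

definition planar_graph :: "'a set \<Rightarrow> 'a set set \<Rightarrow> bool" where
  "planar_graph V E \<longleftrightarrow> simple_graph V E \<and> (\<exists>pos \<gamma>. plane_drawing V E pos \<gamma>)"

definition circular_colouring ::
    "'a set \<Rightarrow> 'a set set \<Rightarrow> nat \<Rightarrow> nat \<Rightarrow> ('a \<Rightarrow> nat) \<Rightarrow> bool" where
  "circular_colouring V E p q c \<longleftrightarrow> c \<in> V \<rightarrow> {..<p} \<and>
     (\<forall>u v. {u, v} \<in> E \<longrightarrow>
        int q \<le> \<bar>int (c u) - int (c v)\<bar> \<and> \<bar>int (c u) - int (c v)\<bar> \<le> int p - int q)"

definition circular_ratios :: "'a set \<Rightarrow> 'a set set \<Rightarrow> real set" where
  "circular_ratios V E =
     {real p / real q | p q. 1 \<le> q \<and> 2 * q \<le> p \<and> (\<exists>c. circular_colouring V E p q c)}"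

definition circular_chromatic_number :: "'a set \<Rightarrow> 'a set set \<Rightarrow> real" where
  "circular_chromatic_number V E = Inf (circular_ratios V E)"

text \<open>For simple graphs the infimum above is taken over a nonempty set that is bounded below,
  so it is the true infimum and not an unspecified real number.\<close>

lemma circular_ratios_ge_2: "x \<in> circular_ratios V E \<Longrightarrow> 2 \<le> x"
proof -
  assume "x \<in> circular_ratios V E"
  then obtain p q where x: "x = real p / real q" and "1 \<le> q" and pq: "2 * q \<le> p"
    unfolding circular_ratios_def by blast
  then have q: "0 < real q" by simp
  have "2 * real q \<le> real p" using pq by linarith
  then show ?thesis using q x by (simp add: pos_le_divide_eq)
qed

lemma bdd_below_circular_ratios: "bdd_below (circular_ratios V E)"
  using circular_ratios_ge_2 by (rule bdd_belowI)

lemma circular_ratios_nonempty: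
  assumes "simple_graph V E"
  shows "circular_ratios V E \<noteq> {}"
proof -
  have "finite V" using assms by (simp add: simple_graph_def)
  from finite_imp_inj_to_nat_seg[OF this]
  obtain c :: "'a \<Rightarrow> nat" and n :: nat where c: "c ` V = {i. i < n}" "inj_on c V"
    by (elim exE conjE)
  have less: "c v < n" if "v \<in> V" for v
    using imageI[OF that, of c] c(1) by simp
  have edge: "u \<in> V \<and> v \<in> V \<and> c u \<noteq> c v" if "{u, v} \<in> E" for u v
  proof -
    have *: "{u, v} \<subseteq> V" "card {u, v} = 2"
      using bspec[OF conjunct2[OF assms[unfolded simple_graph_def]] that] by simp_all
    then have "u \<noteq> v" by auto
    then have "c u \<noteq> c v" using inj_on_eq_iff[OF c(2), of u v] *(1) by simp
    then show ?thesis using *(1) by simp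
  qed
  have "circular_colouring V E (n + 2) 1 c"
    unfolding circular_colouring_def
  proof (intro conjI allI impI)
    show "c \<in> V \<rightarrow> {..<n + 2}" 
    proof
      fix v assume "v \<in> V"
      then show "c v \<in> {..<n + 2}" using less[of v] by simp
    qed
  next
    fix u v assume "{u, v} \<in> E"
    from edge[OF this] less[of u] less[of v] have "c u \<noteq> c v" "c u < n" "c v < n"
      by simp_all
    then show "int 1 \<le> \<bar>int (c u) - int (c v)\<bar>"
      and "\<bar>int (c u) - int (c v)\<bar> \<le> int (n + 2) - int 1" by linarith+
  qed
  moreover have "(1::nat) \<le> 1" "2 * 1 \<le> n + 2" by simp_all
  ultimately have "real (n + 2) / real 1 \<in> circular_ratios V E"
    unfolding circular_ratios_def by blast
  then show ?thesis by blast
qed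

end

theory Submission
  imports Defs
begin

text \<open>
  Scaling by two turns circular \<open>(2g + 1, g)\<close>-colourings into homomorphisms to the cycle
  \<open>C\<^bsub>2g+1\<^esub>\<close>. In \<open>C\<^bsub>2g+1\<^esub>\<close>, walks of length \<open>l \<le> 2g\<close> from a given vertex reach \<open>l + 1\<close> vertices,
  so in a minimal counterexample the threads (paths through vertices of degree two) leaving a vertex
  \<open>v\<close> have lengths \<open>l\<close> with \<open>\<Sum>(2g - l) > 2g\<close>; otherwise \<open>v\<close> and its threads could be coloured last.
  Counting the vertices of degree two from the ends of their threads, this forces
  \<open>(4g - 1) |E| \<ge> 4g |V|\<close>. For plane graphs of girth \<open>8g\<close> Euler's formula says the opposite.

  The half of Euler's formula that is needed, \<open>girth \<cdot> (|E| - |V| + 1) \<le> 2 |E|\<close>, is obtained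
  by adding the edges outside a spanning forest one by one. Each of them closes a Jordan curve \<open>J\<close>
  that meets the previous drawing in a connected set, so by Janiszewski's theorem it splits
  exactly one face, into the points inside and outside \<open>J\<close>. Hence there are enough faces, each edge
  borders at most two of them, and the edges bordering a bounded face contain a cycle because
  forests do not separate the plane.
\<close>

subsection \<open>Colouring sparse graphs of large girth\<close>

text \<open>A homomorphism to the cycle of odd length \<open>N\<close> is written as an integer labelling whose
  values on adjacent vertices differ by \<open>\<plusminus>1\<close> modulo \<open>N\<close>.\<close>

definition cycle_hom :: "int \<Rightarrow> 'a set set \<Rightarrow> ('a \<Rightarrow> int) \<Rightarrow> bool" where
  "cycle_hom N E h \<longleftrightarrow>
     (\<forall>x y. {x, y} \<in> E \<longrightarrow> N dvd (h x - h y - 1) \<or> N dvd (h x - h y + 1))"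

text \<open>The colour of x is \<open>g * h x\<close> reduced modulo 2g + 1. Label differences 1 and
  -1 become g and -g, and two residues in 0..2g that differ by g or -g modulo 2g + 1 are at distance
  g or g + 1.\<close>

lemma cycle_hom_imp_circular_colouring:
  assumes "simple_graph V E" "g \<ge> 1" and h: "cycle_hom (2 * int g + 1) E h"
  shows "\<exists>c. circular_colouring V E (2 * g + 1) g c"
proof -
  let ?N = "2 * int g + 1"
  define r where "r x = (int g * h x) mod ?N" for x
  have r: "0 \<le> r x" "r x \<le> 2 * int g" for x
    using pos_mod_bound[of ?N "int g * h x"] pos_mod_sign[of ?N "int g * h x"]
    unfolding r_def by linarith+
  have dr: "?N dvd (r x - int g * h x)" for x
    unfolding r_def by (simp add: mod_eq_dvd_iff[symmetric])
  have edge: "int g \<le> \<bar>r u - r v\<bar> \<and> \<bar>r u - r v\<bar> \<le> int (2 * g + 1) - int g"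
    if uv: "{u, v} \<in> E" for u v
  proof -
    have "?N dvd (h u - h v - 1) \<or> ?N dvd (h u - h v + 1)"
      using h uv by (auto simp: cycle_hom_def)
    then have "?N dvd (r u - r v - int g) \<or> ?N dvd (r u - r v + int g)"
    proof (elim disjE)
      assume "?N dvd (h u - h v - 1)"
      then have "?N dvd (int g * (h u - h v - 1) + (r u - int g * h u) - (r v - int g * h v))"
        by (intro dvd_diff[OF dvd_add[OF dvd_mult]] dr)
      then show ?thesis by (simp add: algebra_simps)
    next
      assume "?N dvd (h u - h v + 1)"
      then have "?N dvd (int g * (h u - h v + 1) + (r u - int g * h u) - (r v - int g * h v))"
        by (intro dvd_diff[OF dvd_add[OF dvd_mult]] dr)
      then show ?thesis by (simp add: algebra_simps)
    qed
    then obtain k where k: "r u - r v - int g = ?N * k \<or> r u - r v + int g = ?N * k"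
      by (auto elim!: dvdE)
    \<comment> \<open>The residues differ by at most 2g and the shift adds g, so the multiple of 2g
      + 1 is at most 3g in absolute value; this leaves k = -1, 0, 1.\<close>
    have b: "- 3 * int g \<le> ?N * k" "?N * k \<le> 3 * int g"
      using k r[of u] r[of v] by linarith+
    have g0: "0 < int g" using assms(2) by simp
    have "k < 2"
    proof (rule ccontr)
      assume "\<not> k < 2"
      then have "?N * 2 \<le> ?N * k" by (intro mult_left_mono) auto
      then have "?N * 2 \<le> 3 * int g" using b(2) by (rule order_trans)
      then show False using g0 by simp
    qed
    moreover have "k > -2"
    proof (rule ccontr)
      assume "\<not> k > -2"
      then have "?N * k \<le> ?N * (-2)" by (intro mult_left_mono) auto
      with b(1) have "- 3 * int g \<le> ?N * (-2)" by (rule order_trans)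
      then show False using g0 by simp
    qed
    ultimately have "k = -1 \<or> k = 0 \<or> k = 1" by linarith
    then show ?thesis using k r[of u] r[of v] by (elim disjE) auto
  qed
  have "circular_colouring V E (2 * g + 1) g (\<lambda>x. nat (r x))"
    unfolding circular_colouring_def
  proof (intro conjI allI impI)
    have "nat (r x) < 2 * g + 1" for x using r[of x] by linarith
    then show "(\<lambda>x. nat (r x)) \<in> V \<rightarrow> {..<2 * g + 1}" by auto
  qed (use edge r in simp_all)
  then show ?thesis by blast
qed

text \<open>The set collects the colours c from which no walk of l steps along the cycle ends at e
  modulo 2g + 1, where j counts the upward steps. The l + 1 values e + l - 2j are distinct modulo
  the odd number 2g + 1, so at least l + 1 colours stay outside the set.\<close>

lemma card_walk_colours:
  fixes e :: int
  assumes "l \<le> 2 * g"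
  shows "card {c \<in> {0..2 * int g}. \<not> (\<exists>j\<le>l. (2 * int g + 1) dvd (c - e - int l + 2 * int j))} \<le> 2 * g - l"
proof -
  let ?N = "2 * int g + 1"
  let ?A = "{c \<in> {0..2 * int g}. \<exists>j\<le>l. ?N dvd (c - e - int l + 2 * int j)}"
  let ?f = "\<lambda>j. (e + int l - 2 * int j) mod ?N"
  have "inj_on ?f {..l}"
  proof (rule inj_onI)
    fix i j assume ij: "i \<in> {..l}" "j \<in> {..l}" "?f i = ?f j"
    then have "?N dvd (2 * (int j - int i))" by (simp add: mod_eq_dvd_iff algebra_simps)
    \<comment> \<open>The factor 2 is cancelled by (2g + 1) x - g (2 x) = x.\<close>
    then have "?N dvd (?N * (int j - int i) - int g * (2 * (int j - int i)))"
      by (intro dvd_diff[OF dvd_triv_left dvd_mult])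
    then have "?N dvd (int j - int i)" by (simp add: algebra_simps)
    moreover have "\<bar>int j - int i\<bar> < ?N" using ij assms by auto
    ultimately show "i = j" using zdvd_not_zless[of "\<bar>int j - int i\<bar>" ?N] by auto
  qed
  then have img: "card (?f ` {..l}) = Suc l" by (simp add: card_image)
  have sub: "?f ` {..l} \<subseteq> ?A"
  proof (rule image_subsetI)
    fix j assume j: "j \<in> {..l}"
    have "?N dvd (?f j - (e + int l - 2 * int j))" by (simp add: mod_eq_dvd_iff[symmetric])
    then have "?N dvd (?f j - e - int l + 2 * int j)" by (simp add: algebra_simps)
    moreover have "0 \<le> ?f j" "?f j \<le> 2 * int g"
      using pos_mod_bound[of ?N "e + int l - 2 * int j"] pos_mod_sign[of ?N "e + int l - 2 * int j"]
      by linarith+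
    ultimately show "?f j \<in> ?A" using j by auto
  qed
  have fin: "finite ?A" by (rule finite_subset[of _ "{0..2 * int g}"]) auto
  have A: "Suc l \<le> card ?A" using card_mono[OF fin sub] unfolding img .
  have "{c \<in> {0..2 * int g}. \<not> (\<exists>j\<le>l. ?N dvd (c - e - int l + 2 * int j))} = {0..2 * int g} - ?A"
    by auto
  moreover have "card ({0..2 * int g} - ?A) = card {0..2 * int g} - card ?A"
    using fin by (intro card_Diff_subset) auto
  ultimately show ?thesis using A by simp
qed

section \<open>Non-backtracking walks and threads\<close>

definition nb_walk :: "'a set set \<Rightarrow> (nat \<Rightarrow> 'a) \<Rightarrow> nat \<Rightarrow> bool" where
  "nb_walk E x m \<longleftrightarrow> (\<forall>i<m. {x i, x (Suc i)} \<in> E) \<and>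
     (\<forall>i. Suc i < m \<longrightarrow> x i \<noteq> x (Suc (Suc i)))"

lemma nb_walk_rev:
  assumes "nb_walk E x m"
  shows "nb_walk E (\<lambda>i. x (m - i)) m"
  unfolding nb_walk_def
proof (intro conjI allI impI)
  fix i assume "i < m"
  then have "m - i = Suc (m - Suc i)" "m - Suc i < m" by auto
  then show "{x (m - i), x (m - Suc i)} \<in> E"
    using assms by (metis insert_commute nb_walk_def)
next
  fix i assume "Suc i < m"
  then have "m - i = Suc (Suc (m - Suc (Suc i)))" "Suc (m - Suc (Suc i)) < m" by auto
  then show "x (m - i) \<noteq> x (m - Suc (Suc i))"
    using assms by (metis nb_walk_def)
qed

text \<open>Two walks leaving one vertex become a single walk by reversing the first;
  \<open>x 1 \<noteq> y 1\<close> prevents turning back at the common start.\<close>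

lemma nb_walk_join:
  assumes "nb_walk E x l" "nb_walk E y m" "x 0 = y 0" "x 1 \<noteq> y 1" "1 \<le> l" "1 \<le> m"
  shows "nb_walk E (\<lambda>k. if k \<le> l then x (l - k) else y (k - l)) (l + m)"
    (is "nb_walk E ?z _")
  unfolding nb_walk_def
proof (intro conjI allI impI)
  have rx: "nb_walk E (\<lambda>i. x (l - i)) l" by (rule nb_walk_rev[OF assms(1)])
  fix i assume i: "i < l + m"
  show "{?z i, ?z (Suc i)} \<in> E"
  proof (cases "i < l")
    case True
    then show ?thesis using rx by (auto simp: nb_walk_def)
  next
    case False
    then obtain k where k: "i = l + k" by (metis le_add_diff_inverse not_less)
    then have "{y k, y (Suc k)} \<in> E" using i assms(2) by (auto simp: nb_walk_def)
    then show ?thesis using assms(3) k by (cases k) auto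
  qed
next
  have rx: "nb_walk E (\<lambda>i. x (l - i)) l" by (rule nb_walk_rev[OF assms(1)])
  fix i assume i: "Suc i < l + m"
  consider "Suc i < l" | "Suc i = l" | k where "i = l + k"
    by (metis le_add_diff_inverse not_less_eq not_less linorder_neqE_nat)
  then show "?z i \<noteq> ?z (Suc (Suc i))"
  proof cases
    case 1
    then show ?thesis using rx by (auto simp: nb_walk_def)
  next
    case 2
    then show ?thesis using assms(4) by auto
  next
    case 3
    then have "y k \<noteq> y (Suc (Suc k))" using i assms(2) by (auto simp: nb_walk_def)
    moreover have "?z i = y k" using assms(3) 3 by (cases k) auto
    moreover have "Suc (Suc i) - l = Suc (Suc k)" using 3 by simp
    ultimately show ?thesis using 3 by simp
  qed
qed

locale finite_simple_graph =
  fixes V :: "'a set" and E :: "'a set set"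
  assumes simple: "simple_graph V E"
begin

definition nbrs :: "'a \<Rightarrow> 'a set" where
  "nbrs v = {w. {v, w} \<in> E}"

lemma finite_V: "finite V"
  using simple by (simp add: simple_graph_def)

lemma edge_subset: "e \<in> E \<Longrightarrow> e \<subseteq> V"
  using simple by (auto simp: simple_graph_def)

lemma card_edge: "e \<in> E \<Longrightarrow> card e = 2"
  using simple by (auto simp: simple_graph_def)

lemma edge_neq: "{x, y} \<in> E \<Longrightarrow> x \<noteq> y"
  using card_edge[of "{x, y}"] by auto

lemma finite_E: "finite E"
  using edge_subset finite_V by (meson PowI finite_Pow_iff finite_subset subsetI)

lemma nbrs_subset: "nbrs v \<subseteq> V"
  using edge_subset by (auto simp: nbrs_def)

lemma finite_nbrs: "finite (nbrs v)"
  using nbrs_subset finite_V by (rule finite_subset)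

lemma sum_degrees: "(\<Sum>v\<in>V. card (nbrs v)) = 2 * card E"
proof -
  have "card (nbrs v) = card {e\<in>E. v \<in> e}" for v
  proof (rule bij_betw_same_card)
    show "bij_betw (\<lambda>w. {v, w}) (nbrs v) {e\<in>E. v \<in> e}"
      unfolding bij_betw_def
    proof
      show "inj_on (\<lambda>w. {v, w}) (nbrs v)" by (auto simp: inj_on_def doubleton_eq_iff)
      have "e \<in> (\<lambda>w. {v, w}) ` nbrs v" if e: "e \<in> E" "v \<in> e" for e
      proof -
        obtain x y where "e = {x, y}" using card_edge[OF e(1)] by (metis card_2_iff)
        then have "e = {v, x} \<or> e = {v, y}" using e(2) by auto
        then show ?thesis using e(1) by (auto simp: nbrs_def)
      qed
      then show "(\<lambda>w. {v, w}) ` nbrs v = {e\<in>E. v \<in> e}" by (auto simp: nbrs_def)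
    qed
  qed
  then have "(\<Sum>v\<in>V. card (nbrs v)) = (\<Sum>v\<in>V. card {e\<in>E. v \<in> e})" by simp
  also have "\<dots> = (\<Sum>e\<in>E. card {v\<in>V. v \<in> e})"
    using finite_V finite_E by (intro sum_multicount_gen) auto
  also have "\<dots> = (\<Sum>e\<in>E. 2)"
  proof (rule sum.cong)
    fix e assume "e \<in> E"
    then have "{v\<in>V. v \<in> e} = e" using edge_subset by blast
    then show "card {v\<in>V. v \<in> e} = 2" using card_edge \<open>e \<in> E\<close> by simp
  qed simp
  finally show ?thesis by simp
qed

text \<open>A repetition \<open>x i = x (i + d)\<close> with d least bounds a cycle of length d
  \<le> m: d = 1 would be a loop and d = 2 a step back, so d is at least 3, and minimality makes the
  vertices in between distinct.\<close>

lemma nb_walk_inj: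
  assumes x: "nb_walk E x m" and girth: "\<And>vs. is_cycle E vs \<Longrightarrow> m < length vs"
  shows "inj_on x {..m}"
proof (rule ccontr)
  assume "\<not> ?thesis"
  then obtain i0 j0 where "i0 < j0" "j0 \<le> m" "x i0 = x j0"
    unfolding inj_on_def by (metis atMost_iff linorder_neqE_nat)
  then have ex: "\<exists>d i. 1 \<le> d \<and> i + d \<le> m \<and> x i = x (i + d)"
    by (intro exI[of _ "j0 - i0"] exI[of _ i0]) auto
  define d where "d = (LEAST d. \<exists>i. 1 \<le> d \<and> i + d \<le> m \<and> x i = x (i + d))"
  have "\<exists>i. 1 \<le> d \<and> i + d \<le> m \<and> x i = x (i + d)"
    unfolding d_def by (rule LeastI_ex[OF ex])
  then obtain i where i: "1 \<le> d" "i + d \<le> m" "x i = x (i + d)" by blast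
  have least: "d \<le> d'" if "1 \<le> d'" "k + d' \<le> m" "x k = x (k + d')" for k d'
    unfolding d_def using that by (intro Least_le) blast
  have E: "{x k, x (Suc k)} \<in> E" if "k < m" for k using x that by (simp add: nb_walk_def)
  have "d \<noteq> 1" using i E[of i] edge_neq[of "x i" "x (Suc i)"] by auto
  moreover have "d \<noteq> 2"
    using i x unfolding nb_walk_def by (metis add_2_eq_Suc' less_eq_Suc_le add_Suc_right)
  ultimately have d: "3 \<le> d" using i(1) by linarith
  let ?vs = "map (\<lambda>k. x (i + k)) [0..<d]"
  have "inj_on (\<lambda>k. x (i + k)) {0..<d}"
  proof (rule linorder_inj_onI)
    fix a b assume ab: "a < b" "a \<in> {0..<d}" "b \<in> {0..<d}"
    show "x (i + a) \<noteq> x (i + b)"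
    proof
      assume "x (i + a) = x (i + b)"
      then have "d \<le> b - a" using least[of "b - a" "i + a"] ab i(2) by auto
      then show False using ab by auto
    qed
  qed auto
  then have "distinct ?vs" by (simp add: distinct_map)
  moreover have "{?vs ! k, ?vs ! (Suc k mod length ?vs)} \<in> E" if k: "k < length ?vs" for k
  proof (cases "Suc k < d")
    case True
    then show ?thesis using E[of "i + k"] i(2) by simp
  next
    case False
    then have "Suc k = d" using k by simp
    moreover from this have "x (Suc (i + k)) = x i" using i(3) by (metis add_Suc_right)
    ultimately show ?thesis using E[of "i + k"] i(2) by auto
  qed
  ultimately have "is_cycle E ?vs" using d by (simp add: is_cycle_def)
  then show False using girth[of ?vs] i(2) by simp
qed

text \<open>At a vertex of degree two the continuation is forced, so \<open>walk v w\<close> follows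
  the thread leaving v through w. At higher degree the next vertex is an arbitrary choice, and it is
  unspecified if there is no neighbour to choose.\<close>

fun walk :: "'a \<Rightarrow> 'a \<Rightarrow> nat \<Rightarrow> 'a" where
  "walk v w 0 = v"
| "walk v w (Suc 0) = w"
| "walk v w (Suc (Suc k)) = (SOME y. y \<in> nbrs (walk v w (Suc k)) \<and> y \<noteq> walk v w k)"

lemma walk_step:
  assumes "2 \<le> card (nbrs (walk v w (Suc i)))"
  shows "walk v w (Suc (Suc i)) \<in> nbrs (walk v w (Suc i)) \<and> walk v w (Suc (Suc i)) \<noteq> walk v w i"
proof -
  have "\<not> nbrs (walk v w (Suc i)) \<subseteq> {walk v w i}"
    using assms card_mono[of "{walk v w i}" "nbrs (walk v w (Suc i))"] by auto
  then have "\<exists>y. y \<in> nbrs (walk v w (Suc i)) \<and> y \<noteq> walk v w i" by blast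
  then show ?thesis unfolding walk.simps by (rule someI_ex)
qed

lemma nb_walk_walk:
  assumes "w \<in> nbrs v" "\<And>i. 1 \<le> i \<Longrightarrow> i < m \<Longrightarrow> 2 \<le> card (nbrs (walk v w i))"
  shows "nb_walk E (walk v w) m"
proof -
  have step: "walk v w (Suc (Suc i)) \<in> nbrs (walk v w (Suc i)) \<and> walk v w (Suc (Suc i)) \<noteq> walk v w i"
    if "Suc i < m" for i
    using walk_step assms(2) that by (metis One_nat_def Suc_leI zero_less_Suc)
  have "{walk v w i, walk v w (Suc i)} \<in> E" if "i < m" for i
  proof (cases i)
    case 0
    then show ?thesis using assms(1) by (simp add: nbrs_def)
  next
    case (Suc k)
    then show ?thesis using step[of k] that by (simp add: nbrs_def del: walk.simps(3))
  qed
  then show ?thesis using step unfolding nb_walk_def by metis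
qed

lemma nbrs_degree_2:
  assumes "card (nbrs y) = 2" "a \<in> nbrs y" "b \<in> nbrs y" "a \<noteq> b"
  shows "nbrs y = {a, b}"
  using assms finite_nbrs by (intro card_seteq[symmetric]) auto

text \<open>Degree two leaves a single way to go on without turning back, so the choice in
  \<open>walk\<close> must agree with y. This recognises a thread traversed from its other end as a
  \<open>walk\<close> again.\<close>

lemma walk_eqI:
  assumes y: "nb_walk E y m" and deg: "\<And>i. 1 \<le> i \<Longrightarrow> i < m \<Longrightarrow> card (nbrs (y i)) = 2"
  shows "i \<le> m \<Longrightarrow> walk (y 0) (y 1) i = y i"
proof (induction i rule: induct_nat_012)
  case (ge2 n)
  have ed: "y n \<in> nbrs (y (Suc n))" "y (Suc (Suc n)) \<in> nbrs (y (Suc n))" "y n \<noteq> y (Suc (Suc n))"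
    using y ge2.prems by (auto simp: nb_walk_def nbrs_def insert_commute)
  have "nbrs (y (Suc n)) = {y n, y (Suc (Suc n))}"
    using nbrs_degree_2[OF deg ed] ge2.prems by simp
  then have "(SOME z. z \<in> nbrs (y (Suc n)) \<and> z \<noteq> y n) = y (Suc (Suc n))"
    using ed(3) by (intro some_equality) auto
  then show ?case using ge2 by simp
qed auto


text \<open>Threads through different neighbours join to one walk of length l + m, and threads
  through the same neighbour are parts of one walk; below the girth either walk is
  injective.\<close>

lemma walks_disjoint:
  assumes "w \<in> nbrs v" "w' \<in> nbrs v"
    and "nb_walk E (walk v w) l" "nb_walk E (walk v w') m" "1 \<le> l" "1 \<le> m"
    and girth: "\<And>vs. is_cycle E vs \<Longrightarrow> l + m < length vs"
    and ij: "i \<le> l" "j \<le> m" "walk v w i = walk v w' j"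
  shows "i = j \<and> (i = 0 \<or> w = w')"
proof (cases "w = w'")
  case True
  have "nb_walk E (walk v w) (max l m)"
    using True assms(3,4) by (auto simp: max_def)
  moreover have "max l m < length vs" if "is_cycle E vs" for vs
    using girth[OF that] by auto
  ultimately have "inj_on (walk v w) {..max l m}" by (rule nb_walk_inj)
  then show ?thesis using ij True by (auto dest: inj_onD)
next
  case False
  let ?z = "\<lambda>k. if k \<le> l then walk v w (l - k) else walk v w' (k - l)"
  have "nb_walk E ?z (l + m)"
    using assms(3-6) False by (intro nb_walk_join) auto
  then have "inj_on ?z {..l + m}" using girth by (rule nb_walk_inj)
  moreover have "?z (l - i) = ?z (l + j)" using ij by (cases j) auto
  ultimately have "l - i = l + j" by (rule inj_onD) (use ij in auto)
  then show ?thesis using ij(1) assms(5) by auto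
qed

text \<open>Deleting \<open>v\<close> together with the inner vertices of the threads leaving it, the colour of the
  far end of a thread of length \<open>l\<close> rules out at most \<open>2g - l\<close> of the \<open>2g + 1\<close> colours for \<open>v\<close>.\<close>

lemma star_reducible:
  fixes g :: nat
  assumes g: "1 \<le> g" and v: "v \<in> V"
    and girth: "\<And>vs. is_cycle E vs \<Longrightarrow> 8 * g \<le> length vs"
    and l: "\<And>w. w \<in> nbrs v \<Longrightarrow> 1 \<le> l w \<and> l w \<le> 2 * g"
    and deg: "\<And>w i. w \<in> nbrs v \<Longrightarrow> 1 \<le> i \<Longrightarrow> i < l w \<Longrightarrow> card (nbrs (walk v w i)) = 2"
    and sum: "(\<Sum>w\<in>nbrs v. 2 * g - l w) \<le> 2 * g"
    and IH: "\<And>W. W \<subset> V \<Longrightarrow> \<exists>h. cycle_hom (2 * int g + 1) {e\<in>E. e \<subseteq> W} h"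
  shows "\<exists>h. cycle_hom (2 * int g + 1) E h"
proof -
  let ?N = "2 * int g + 1"
  define T where "T = insert v {walk v w i | w i. w \<in> nbrs v \<and> 1 \<le> i \<and> i < l w}"
  have nb: "nb_walk E (walk v w) (l w)" if "w \<in> nbrs v" for w
    using nb_walk_walk[OF that, of "l w"] deg[OF that] by simp
  \<comment> \<open>Two threads have total length at most 4g, which is below the girth, so they
    share only the vertex v.\<close>
  have uniq: "i = j \<and> (i = 0 \<or> w = w')"
    if "w \<in> nbrs v" "w' \<in> nbrs v" "i \<le> l w" "j \<le> l w'" "walk v w i = walk v w' j" for w w' i j
  proof (rule walks_disjoint[OF that(1,2) nb[OF that(1)] nb[OF that(2)] _ _ _ that(3-5)])
    show "l w + l w' < length vs" if "is_cycle E vs" for vs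
      using girth[OF that] l[OF \<open>w \<in> nbrs v\<close>] l[OF \<open>w' \<in> nbrs v\<close>] g by linarith
  qed (use l that in auto)
  have "V - T \<subset> V" using v by (auto simp: T_def)
  then obtain h0 where h0: "cycle_hom ?N {e\<in>E. e \<subseteq> V - T} h0" using IH by blast
  \<comment> \<open>The colours of v that cannot be continued along the thread through w to match
    the colour of its far end.\<close>
  define bad where "bad w = {c \<in> {0..2 * int g}.
      \<not> (\<exists>j\<le>l w. ?N dvd (c - h0 (walk v w (l w)) - int (l w) + 2 * int j))}" for w
  have "card (\<Union>w\<in>nbrs v. bad w) \<le> (\<Sum>w\<in>nbrs v. card (bad w))"
    by (rule card_UN_le[OF finite_nbrs])
  also have "\<dots> \<le> (\<Sum>w\<in>nbrs v. 2 * g - l w)"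
    unfolding bad_def using l by (intro sum_mono card_walk_colours) auto
  finally have "card (\<Union>w\<in>nbrs v. bad w) < card {0..2 * int g}" using sum by simp
  moreover have "finite (bad w)" for w
    unfolding bad_def by (rule finite_subset[of _ "{0..2 * int g}"]) auto
  then have "finite (\<Union>w\<in>nbrs v. bad w)" using finite_nbrs by blast
  ultimately have "\<not> {0..2 * int g} \<subseteq> (\<Union>w\<in>nbrs v. bad w)"
    using card_mono by (metis leD)
  then obtain c where "\<forall>w\<in>nbrs v. \<exists>j\<le>l w. ?N dvd (c - h0 (walk v w (l w)) - int (l w) + 2 * int j)"
    unfolding bad_def by blast
  then obtain j where j: "\<And>w. w \<in> nbrs v \<Longrightarrow> j w \<le> l w"
    "\<And>w. w \<in> nbrs v \<Longrightarrow> ?N dvd (c - h0 (walk v w (l w)) - int (l w) + 2 * int (j w))"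
    by metis
  \<comment> \<open>The thread goes up for \<open>j w\<close> steps and down afterwards; at
    \<open>i = l w\<close> this yields c - l w + 2 (j w), the colour of the far end modulo 2g +
    1.\<close>
  define p where "p w i = c + (if i \<le> j w then int i else 2 * int (j w) - int i)" for w i
  have p_step: "p w (Suc i) - p w i = 1 \<or> p w (Suc i) - p w i = -1" for w i
    by (auto simp: p_def)
  \<comment> \<open>By \<open>uniq\<close> an inner vertex has one position on one thread, and
    \<open>SOME\<close> recovers it.\<close>
  define h where "h x = (if x = v then c else if x \<in> T then
      (case SOME (w, i). w \<in> nbrs v \<and> 1 \<le> i \<and> i < l w \<and> walk v w i = x of (w, i) \<Rightarrow> p w i)
      else h0 x)" for x
  have h_v: "h v = c" by (simp add: h_def)
  have notv: "walk v w i \<noteq> v" if "w \<in> nbrs v" "1 \<le> i" "i \<le> l w" for w i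
    using uniq[of w w i 0] that by auto
  have h_inner: "h (walk v w i) = p w i" if w: "w \<in> nbrs v" "1 \<le> i" "i < l w" for w i
  proof -
    have "(SOME (w', i'). w' \<in> nbrs v \<and> 1 \<le> i' \<and> i' < l w' \<and> walk v w' i' = walk v w i) = (w, i)"
    proof (rule some_equality)
      show "case (w, i) of (w', i') \<Rightarrow> w' \<in> nbrs v \<and> 1 \<le> i' \<and> i' < l w' \<and> walk v w' i' = walk v w i"
        using w by simp
    next
      fix q assume "case q of (w', i') \<Rightarrow> w' \<in> nbrs v \<and> 1 \<le> i' \<and> i' < l w' \<and> walk v w' i' = walk v w i"
      then obtain w' i' where "q = (w', i')" "w' \<in> nbrs v" "1 \<le> i'" "i' < l w'"
          "walk v w' i' = walk v w i" by auto
      then show "q = (w, i)" using uniq[of w' w i' i] w by auto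
    qed
    moreover have "walk v w i \<noteq> v" using notv w by auto
    moreover have "walk v w i \<in> T" using w by (auto simp: T_def)
    ultimately show ?thesis by (simp add: h_def)
  qed
  \<comment> \<open>The far end keeps its old label, which agrees with \<open>p\<close> only modulo
    2g + 1; hence a divisibility instead of an equation.\<close>
  have h_walk: "?N dvd (h (walk v w k) - p w k)" if w: "w \<in> nbrs v" "k \<le> l w" for w k
  proof -
    consider "k = 0" | "1 \<le> k" "k < l w" | "1 \<le> k" "k = l w" using w(2) by linarith
    then show ?thesis
    proof cases
      case 1
      then show ?thesis by (simp add: h_v p_def)
    next
      case 2
      then show ?thesis using h_inner w(1) by simp
    next
      case 3
      have "walk v w k \<noteq> walk v w' i" if "w' \<in> nbrs v" "i < l w'" "1 \<le> i" for w' i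
        using uniq[of w w' k i] w that 3 by auto
      then have "walk v w k \<notin> T" using notv[of w k] w 3 by (auto simp: T_def)
      then have "h (walk v w k) = h0 (walk v w (l w))" using 3 by (auto simp: h_def T_def)
      moreover have "p w k = c - int (l w) + 2 * int (j w)" using j(1)[OF w(1)] 3 by (auto simp: p_def)
      ultimately have "h (walk v w k) - p w k = - (c - h0 (walk v w (l w)) - int (l w) + 2 * int (j w))"
        by simp
      then show ?thesis using j(2)[OF w(1)] by (simp only: dvd_minus_iff)
    qed
  qed
  have shift: "?N dvd (a - b - d)"
    if "?N dvd (a - a')" "?N dvd (b - b')" "a' - b' = d" for a b a' b' d :: int
  proof -
    have "?N dvd ((a - a') - (b - b'))" using that(1,2) by (rule dvd_diff)
    then show ?thesis using that(3) by (simp add: algebra_simps)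
  qed
  have consec: "?N dvd (h (walk v w k) - h (walk v w (Suc k)) - 1)
      \<or> ?N dvd (h (walk v w k) - h (walk v w (Suc k)) + 1)"
    if w: "w \<in> nbrs v" "Suc k \<le> l w" for w k
    using shift[OF h_walk[of w k] h_walk[of w "Suc k"], of "-1"]
      shift[OF h_walk[of w k] h_walk[of w "Suc k"], of 1] p_step[of w k] w
    by auto
  have flip: "?N dvd (h y - h x - 1) \<or> ?N dvd (h y - h x + 1)"
    if "?N dvd (h x - h y - 1) \<or> ?N dvd (h x - h y + 1)" for x y
  proof -
    have "?N dvd - (h x - h y - 1) \<or> ?N dvd - (h x - h y + 1)"
      using that by (simp only: dvd_minus_iff)
    moreover have "- (h x - h y - 1) = h y - h x + 1" "- (h x - h y + 1) = h y - h x - 1" by simp_all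
    ultimately show ?thesis by metis
  qed
  \<comment> \<open>An edge at a deleted vertex joins consecutive vertices of a thread: at v by the
    choice of the threads, at an inner vertex because its degree is two.\<close>
  have edge_T: "?N dvd (h x - h y - 1) \<or> ?N dvd (h x - h y + 1)"
    if x: "x \<in> T" and xy: "{x, y} \<in> E" for x y
  proof (cases "x = v")
    case True
    then have "y \<in> nbrs v" using xy by (simp add: nbrs_def)
    then show ?thesis using consec[of y 0] l[of y] True by simp
  next
    case False
    then obtain w i where w: "w \<in> nbrs v" "1 \<le> i" "i < l w" "x = walk v w i"
      using x by (auto simp: T_def)
    then obtain k where k: "i = Suc k" by (cases i) auto
    have "{walk v w k, walk v w i} \<in> E" "{walk v w i, walk v w (Suc i)} \<in> E"
        "walk v w k \<noteq> walk v w (Suc i)"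
      using nb[OF w(1)] w(3) unfolding nb_walk_def k by auto
    then have "walk v w k \<in> nbrs x" "walk v w (Suc i) \<in> nbrs x" "walk v w k \<noteq> walk v w (Suc i)"
      unfolding nbrs_def w(4) by (auto simp: insert_commute simp del: walk.simps(3))
    then have "nbrs x = {walk v w k, walk v w (Suc i)}"
      using nbrs_degree_2[of x "walk v w k" "walk v w (Suc i)"] deg[OF w(1-3)] w(4) by simp
    moreover have "y \<in> nbrs x" using xy by (simp add: nbrs_def)
    ultimately consider "y = walk v w k" | "y = walk v w (Suc i)" by blast
    then show ?thesis
    proof cases
      case 1
      have "Suc k \<le> l w" using w(3) k by simp
      then show ?thesis using flip[OF consec[OF w(1)]] unfolding w(4) k 1 by blast
    next
      case 2
      have "Suc i \<le> l w" using w(3) by simp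
      then show ?thesis using consec[OF w(1)] unfolding w(4) 2 by blast
    qed
  qed
  have "?N dvd (h x - h y - 1) \<or> ?N dvd (h x - h y + 1)" if xy: "{x, y} \<in> E" for x y
  proof (cases "x \<in> T \<or> y \<in> T")
    case True
    moreover have "{y, x} \<in> E" using xy by (simp add: insert_commute)
    ultimately show ?thesis using edge_T[OF _ xy] flip[OF edge_T[of y x]] by blast
  next
    case False
    moreover have "{x, y} \<subseteq> V" using edge_subset xy by blast
    ultimately have "?N dvd (h0 x - h0 y - 1) \<or> ?N dvd (h0 x - h0 y + 1)"
      using h0 xy by (auto simp: cycle_hom_def)
    moreover have "h x = h0 x" "h y = h0 y" using False by (auto simp: h_def T_def)
    ultimately show ?thesis by simp
  qed
  then show ?thesis unfolding cycle_hom_def by blast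
qed

text \<open>Since no star is reducible, the threads at each vertex satisfy \<Sum>(2g - l) > 2g. Both
  directions from a vertex of degree two then lead to vertices of degree at least three, so twice
  the number of vertices of degree two is at most the number of inner thread positions counted from
  the latter, which is bounded locally.\<close>

lemma minimal_not_sparse:
  fixes g :: nat
  assumes g: "1 \<le> g"
    and girth: "\<And>vs. is_cycle E vs \<Longrightarrow> 8 * g \<le> length vs"
    and IH: "\<And>W. W \<subset> V \<Longrightarrow> \<exists>h. cycle_hom (2 * int g + 1) {e\<in>E. e \<subseteq> W} h"
    and no: "\<nexists>h. cycle_hom (2 * int g + 1) E h"
  shows "4 * g * card V \<le> (4 * g - 1) * card E"
proof -
  let ?deg = "\<lambda>v. card (nbrs v)"
  \<comment> \<open>Threads are cut off at length 2g, where 2g - l has reached 0 and the far end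
    forbids no colour.\<close>
  define len where "len v w = (LEAST i. 1 \<le> i \<and> (3 \<le> ?deg (walk v w i) \<or> i = 2 * g))" for v w
  have len: "1 \<le> len v w \<and> (3 \<le> ?deg (walk v w (len v w)) \<or> len v w = 2 * g)" for v w
    unfolding len_def by (rule LeastI[of _ "2 * g"]) (use g in simp)
  have len_le: "len v w \<le> 2 * g" for v w
    unfolding len_def by (rule Least_le) (use g in simp)
  have len_less: "?deg (walk v w i) < 3" if "1 \<le> i" "i < len v w" for v w i
    using not_less_Least[OF that(2)[unfolded len_def]] that(1) by auto
  \<comment> \<open>With degree at most one, threads of length 1 suffice: they forbid at most 2g - 1
    colours.\<close>
  have deg2: "2 \<le> ?deg v" if v: "v \<in> V" for v
  proof (rule ccontr)
    assume "\<not> 2 \<le> ?deg v"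
    then have "?deg v * (2 * g - 1) \<le> 1 * (2 * g - 1)" by (intro mult_right_mono) auto
    also have "\<dots> \<le> 2 * g" by simp
    finally have "(\<Sum>w\<in>nbrs v. 2 * g - 1) \<le> 2 * g" by simp
    then have "\<exists>h. cycle_hom (2 * int g + 1) E h"
      using star_reducible[OF g v girth, of "\<lambda>_. 1"] g IH by auto
    then show False using no by simp
  qed
  have walk_V: "walk v w i \<in> V" if "v \<in> V" "w \<in> nbrs v" for v w i
  proof (induction i rule: induct_nat_012)
    case 0
    then show ?case using that by simp
  next
    case 1
    then show ?case using that nbrs_subset by auto
  next
    case (ge2 n)
    then show ?case using walk_step[OF deg2, of v w n] nbrs_subset by blast
  qed
  have star: "2 * g + 1 \<le> (\<Sum>w\<in>nbrs v. 2 * g - len v w)" if v: "v \<in> V" for v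
  proof (rule ccontr)
    assume "\<not> ?thesis"
    then have "(\<Sum>w\<in>nbrs v. 2 * g - len v w) \<le> 2 * g" by simp
    moreover have "?deg (walk v w i) = 2" if "w \<in> nbrs v" "1 \<le> i" "i < len v w" for w i
      using deg2[OF walk_V[OF v that(1), of i]] len_less[OF that(2,3)] by linarith
    ultimately have "\<exists>h. cycle_hom (2 * int g + 1) E h"
      using star_reducible[OF g v girth, of "len v"] len len_le IH by blast
    then show False using no by simp
  qed
  define X where "X = {v\<in>V. 3 \<le> ?deg v}"
  define V2 where "V2 = {v\<in>V. ?deg v = 2}"
  have fin: "finite X" "finite V2" "X \<inter> V2 = {}" using finite_V by (auto simp: X_def V2_def)
  have "v \<in> X \<union> V2" if "v \<in> V" for v
    using deg2[OF that] that unfolding X_def V2_def by (cases "?deg v = 2") auto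
  then have V: "V = X \<union> V2" by (auto simp: X_def V2_def)
  \<comment> \<open>The other thread at x contributes at most 2g - 1 to a sum exceeding 2g. So the
    thread through a stops before the cutoff, at a vertex of degree at least three.\<close>
  have short: "len x a < 2 * g" if x: "x \<in> V2" "a \<in> nbrs x" for x a
  proof -
    have "(\<Sum>w\<in>nbrs x - {a}. 2 * g - len x w) \<le> (\<Sum>w\<in>nbrs x - {a}. 2 * g - 1)"
      using len by (intro sum_mono diff_le_mono2) blast
    also have "\<dots> = card (nbrs x - {a}) * (2 * g - 1)" by simp
    also have "card (nbrs x - {a}) = 1" using x by (simp add: V2_def finite_nbrs)
    finally have "(\<Sum>w\<in>nbrs x - {a}. 2 * g - len x w) \<le> 2 * g - 1" by simp
    moreover have "(\<Sum>w\<in>nbrs x. 2 * g - len x w)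
        = (2 * g - len x a) + (\<Sum>w\<in>nbrs x - {a}. 2 * g - len x w)"
      using x finite_nbrs by (intro sum.remove) auto
    ultimately show ?thesis using star[of x] x by (simp add: V2_def)
  qed
  define S where "S = Sigma X (\<lambda>v. Sigma (nbrs v) (\<lambda>w. {1..<len v w}))"
  have finS: "finite S" unfolding S_def using fin finite_nbrs by auto
  have cardS: "card S = (\<Sum>v\<in>X. \<Sum>w\<in>nbrs v. len v w - 1)"
    unfolding S_def using fin finite_nbrs by (simp add: card_SigmaI)
  \<comment> \<open>The thread from x through a is followed to its end \<open>y 0\<close> in
    \<open>X\<close>; read backwards it has x at position m and a at position m - 1.\<close>
  have "Sigma V2 nbrs \<subseteq> (\<lambda>(v, w, i). (walk v w i, walk v w (i - 1))) ` S"
  proof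
    fix q assume "q \<in> Sigma V2 nbrs"
    then obtain x a where q: "q = (x, a)" "x \<in> V2" "a \<in> nbrs x" by blast
    then have xV: "x \<in> V" by (simp add: V2_def)
    define m where "m = len x a"
    define y where "y i = walk x a (m - i)" for i
    have m: "1 \<le> m" "m < 2 * g" "3 \<le> ?deg (walk x a m)"
      using short[OF q(2,3)] len[of x a] by (auto simp: m_def)
    have deg_y: "?deg (y i) = 2" if i: "1 \<le> i" "i \<le> m" for i
    proof (cases "i = m")
      case True
      then show ?thesis using q(2) by (simp add: y_def V2_def)
    next
      case False
      then have "1 \<le> m - i" "m - i < len x a" using i by (auto simp: m_def)
      then show ?thesis
        using len_less deg2[OF walk_V[OF xV q(3), of "m - i"]] unfolding y_def by fastforce
    qed
    have "nb_walk E (walk x a) m"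
      using deg2[OF walk_V[OF xV q(3)]] by (intro nb_walk_walk q) auto
    then have nb: "nb_walk E y m" unfolding y_def by (rule nb_walk_rev)
    have y: "walk (y 0) (y 1) i = y i" if "i \<le> m" for i
      using walk_eqI[OF nb _ that] deg_y by simp
    have "{y 0, y 1} \<in> E" using nb m(1) by (auto simp: nb_walk_def)
    then have y01: "y 1 \<in> nbrs (y 0)" by (simp add: nbrs_def)
    have "y 0 \<in> X" using m(3) walk_V[OF xV q(3), of m] by (simp add: X_def y_def)
    \<comment> \<open>Positions 1 to m of the reversed thread have degree two and m < 2g, so neither
      stopping condition of \<open>len\<close> holds up to m.\<close>
    moreover have "m < len (y 0) (y 1)"
    proof (rule ccontr)
      let ?k = "len (y 0) (y 1)"
      assume "\<not> m < ?k"
      then have "?deg (walk (y 0) (y 1) ?k) = 2" "?k < 2 * g"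
        using y[of ?k] deg_y[of ?k] len[of "y 0" "y 1"] m(2) by auto
      then show False using len[of "y 0" "y 1"] by auto
    qed
    ultimately have "(y 0, y 1, m) \<in> S" using y01 m(1) by (auto simp: S_def)
    moreover have "(walk (y 0) (y 1) m, walk (y 0) (y 1) (m - 1)) = q"
      using y[of m] y[of "m - 1"] m(1) q(1) by (simp add: y_def)
    ultimately show "q \<in> (\<lambda>(v, w, i). (walk v w i, walk v w (i - 1))) ` S"
      by (intro image_eqI[of _ _ "(y 0, y 1, m)"]) auto
  qed
  then have "card (Sigma V2 nbrs) \<le> card S" using finS by (rule surj_card_le[rotated])
  moreover have "card (Sigma V2 nbrs) = 2 * card V2"
    using fin finite_nbrs by (simp add: card_SigmaI V2_def)
  ultimately have count: "2 * card V2 \<le> (\<Sum>v\<in>X. \<Sum>w\<in>nbrs v. len v w - 1)"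
    using cardS by simp
  have local: "int (\<Sum>w\<in>nbrs v. len v w - 1) \<le> (4 * int g - 1) * int (?deg v) - 8 * int g"
    if v: "v \<in> X" for v
  proof -
    have "int (2 * g + 1) \<le> int (\<Sum>w\<in>nbrs v. 2 * g - len v w)"
      using star[of v] v by (simp only: of_nat_le_iff) (simp add: X_def)
    also have "\<dots> = (\<Sum>w\<in>nbrs v. 2 * int g - int (len v w))"
      using len_le by (simp add: of_nat_diff)
    finally have 1: "2 * int g + 1 \<le> 2 * int g * int (?deg v) - (\<Sum>w\<in>nbrs v. int (len v w))"
      by (simp add: sum_subtractf algebra_simps)
    have "int (\<Sum>w\<in>nbrs v. len v w - 1) = (\<Sum>w\<in>nbrs v. int (len v w) - 1)"
      using len by (simp add: of_nat_diff)
    also have "\<dots> = (\<Sum>w\<in>nbrs v. int (len v w)) - int (?deg v)"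
      by (simp add: sum_subtractf)
    finally have 2: "int (\<Sum>w\<in>nbrs v. len v w - 1) \<le> 2 * int g * int (?deg v) - 2 * int g - 1 - int (?deg v)"
      using 1 by linarith
    \<comment> \<open>With d the degree, (4g - 1) d - 8g exceeds (2g - 1) d - 2g - 1 by 2g d - 6g +
      1, which is positive for d \<ge> 3.\<close>
    have "2 * int g * 3 \<le> 2 * int g * int (?deg v)"
      using v by (intro mult_left_mono) (auto simp: X_def)
    then show ?thesis using 2 by (simp add: algebra_simps)
  qed
  have "2 * int (card V2) \<le> (\<Sum>v\<in>X. int (\<Sum>w\<in>nbrs v. len v w - 1))"
    using count by (simp only: of_nat_sum[symmetric])
  also have "\<dots> \<le> (\<Sum>v\<in>X. (4 * int g - 1) * int (?deg v) - 8 * int g)"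
    by (intro sum_mono local)
  also have "\<dots> = (4 * int g - 1) * (\<Sum>v\<in>X. int (?deg v)) - 8 * int g * int (card X)"
    by (simp add: sum_subtractf sum_distrib_left)
  finally have A: "2 * int (card V2) \<le> (4 * int g - 1) * (\<Sum>v\<in>X. int (?deg v)) - 8 * int g * int (card X)" .
  have "(\<Sum>v\<in>V. ?deg v) = (\<Sum>v\<in>X. ?deg v) + (\<Sum>v\<in>V2. ?deg v)"
    using fin V by (simp add: sum.union_disjoint)
  moreover have "(\<Sum>v\<in>V2. ?deg v) = 2 * card V2" by (simp add: V2_def)
  ultimately have "2 * card E = (\<Sum>v\<in>X. ?deg v) + 2 * card V2" using sum_degrees by simp
  then have E: "(\<Sum>v\<in>X. int (?deg v)) = 2 * int (card E) - 2 * int (card V2)"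
    by (simp flip: of_nat_sum)
  have cV: "card V = card X + card V2" using fin V by (simp add: card_Un_disjoint)
  have "4 * int g * int (card V) \<le> (4 * int g - 1) * int (card E)"
    using A unfolding E cV by (simp add: algebra_simps)
  moreover have "int (4 * g - 1) = 4 * int g - 1" using g by simp
  ultimately have "int (4 * g * card V) \<le> int ((4 * g - 1) * card E)" by simp
  then show ?thesis by (simp only: of_nat_le_iff)
qed

end

section \<open>Induction over induced subgraphs\<close>

lemma simple_graph_induced:
  assumes "simple_graph V E" "W \<subseteq> V"
  shows "simple_graph W {e\<in>E. e \<subseteq> W}"
  using assms by (auto simp: simple_graph_def intro: finite_subset)

text \<open>Sparsity is demanded of all nonempty vertex subsets so that it passes to induced
  subgraphs. Induction on the number of vertices colours the proper ones, and
  \<open>minimal_not_sparse\<close> then contradicts the case W = V.\<close>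

lemma sparse_imp_cycle_hom:
  fixes g :: nat
  assumes "1 \<le> g" "simple_graph V E"
    and "\<And>vs. is_cycle E vs \<Longrightarrow> 8 * g \<le> length vs"
    and "\<And>W. W \<subseteq> V \<Longrightarrow> W \<noteq> {} \<Longrightarrow> (4 * g - 1) * card {e\<in>E. e \<subseteq> W} < 4 * g * card W"
  shows "\<exists>h. cycle_hom (2 * int g + 1) E h"
  using assms(2-)
proof (induction "card V" arbitrary: V E rule: less_induct)
  case less
  interpret finite_simple_graph V E by unfold_locales fact
  show ?case
  proof (rule ccontr)
    assume no: "\<nexists>h. cycle_hom (2 * int g + 1) E h"
    have IH: "\<exists>h. cycle_hom (2 * int g + 1) {e\<in>E. e \<subseteq> W} h" if W: "W \<subset> V" for W
    proof (rule less.hyps)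
      show "card W < card V" using W finite_V by (rule psubset_card_mono[rotated])
      show "simple_graph W {e\<in>E. e \<subseteq> W}"
        using simple W by (intro simple_graph_induced) auto
      show "8 * g \<le> length vs" if "is_cycle {e\<in>E. e \<subseteq> W} vs" for vs
        using less.prems(2) that by (auto simp: is_cycle_def)
      fix U assume U: "U \<subseteq> W" "U \<noteq> {}"
      then have "{e \<in> {e\<in>E. e \<subseteq> W}. e \<subseteq> U} = {e\<in>E. e \<subseteq> U}" by auto
      then show "(4 * g - 1) * card {e \<in> {e\<in>E. e \<subseteq> W}. e \<subseteq> U} < 4 * g * card U"
        using less.prems(3)[of U] U W by auto
    qed
    have "4 * g * card V \<le> (4 * g - 1) * card E"
      using minimal_not_sparse[OF assms(1) less.prems(2) IH no] by blast
    moreover have "{e\<in>E. e \<subseteq> V} = E" using edge_subset by blast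
    moreover have "V \<noteq> {}"
    proof
      assume "V = {}"
      then have "E = {}" using edge_subset card_edge by fastforce
      then show False using no by (auto simp: cycle_hom_def)
    qed
    ultimately show False using less.prems(3)[of V] by simp
  qed
qed

subsection \<open>Spanning forests\<close>

definition adj :: "'a set set \<Rightarrow> ('a \<times> 'a) set" where
  "adj F = {(u, v). {u, v} \<in> F}"

lemma adj_iff: "(u, v) \<in> adj F \<longleftrightarrow> {u, v} \<in> F"
  by (simp add: adj_def)

lemma adj_mono: "F \<subseteq> G \<Longrightarrow> adj F \<subseteq> adj G"
  by (auto simp: adj_def)

lemma reach_mono: "F \<subseteq> G \<Longrightarrow> (u, v) \<in> (adj F)\<^sup>* \<Longrightarrow> (u, v) \<in> (adj G)\<^sup>*"
  using rtrancl_mono[OF adj_mono] by blast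

lemma reach_sym: "(u, v) \<in> (adj F)\<^sup>* \<Longrightarrow> (v, u) \<in> (adj F)\<^sup>*"
proof -
  have "sym (adj F)" by (auto simp: sym_def adj_def insert_commute)
  then show "(u, v) \<in> (adj F)\<^sup>* \<Longrightarrow> (v, u) \<in> (adj F)\<^sup>*"
    using sym_rtrancl symD by metis
qed

text \<open>When the next vertex already occurs on the path, the path is cut off there.\<close>

lemma reach_imp_distinct_path:
  assumes "(u, v) \<in> (adj F)\<^sup>*"
  shows "\<exists>xs. xs \<noteq> [] \<and> hd xs = u \<and> last xs = v \<and> distinct xs \<and>
           (\<forall>i. Suc i < length xs \<longrightarrow> {xs ! i, xs ! Suc i} \<in> F)"
  using assms
proof (induction rule: rtrancl_induct)
  case base
  show ?case by (rule exI[of _ "[u]"]) simp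
next
  case (step y z)
  then obtain xs where xs: "xs \<noteq> []" "hd xs = u" "last xs = y" "distinct xs"
    "\<And>i. Suc i < length xs \<Longrightarrow> {xs ! i, xs ! Suc i} \<in> F" by blast
  show ?case
  proof (cases "z \<in> set xs")
    case True
    then obtain k where k: "k < length xs" "xs ! k = z" by (auto simp: in_set_conv_nth)
    have "last (take (Suc k) xs) = z" using k by (simp add: take_Suc_conv_app_nth)
    then show ?thesis using xs k
      by (intro exI[of _ "take (Suc k) xs"]) (auto simp: hd_take)
  next
    case False
    have "{(xs @ [z]) ! i, (xs @ [z]) ! Suc i} \<in> F" if i: "Suc i < length (xs @ [z])" for i
    proof (cases "Suc i < length xs")
      case True
      then show ?thesis using xs(5)[OF True] by (simp add: nth_append)
    next
      case False
      then have eq: "Suc i = length xs" using i by simp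
      then have "xs ! i = y" using xs(1,3) by (metis diff_Suc_1 last_conv_nth)
      then show ?thesis using eq step(2) by (simp add: nth_append adj_iff)
    qed
    then show ?thesis using xs False by (intro exI[of _ "xs @ [z]"]) auto
  qed
qed

text \<open>The edge closes a path of distinct vertices from u to v. This path has at least three
  vertices, because u and v differ and are not adjacent in F.\<close>

lemma reach_imp_cycle:
  assumes "(u, v) \<in> (adj F)\<^sup>*" "u \<noteq> v" "{u, v} \<notin> F"
  shows "\<exists>vs. is_cycle (insert {u, v} F) vs"
proof -
  obtain xs where xs: "xs \<noteq> []" "hd xs = u" "last xs = v" "distinct xs"
    "\<And>i. Suc i < length xs \<Longrightarrow> {xs ! i, xs ! Suc i} \<in> F"
    using reach_imp_distinct_path[OF assms(1)] by blast
  have h: "xs ! 0 = u" "xs ! (length xs - 1) = v"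
    using xs by (simp_all add: hd_conv_nth last_conv_nth)
  have "length xs \<noteq> 1" using h assms(2) by auto
  moreover have "length xs \<noteq> 2" using h assms(3) xs(5)[of 0] by auto
  moreover have "length xs \<noteq> 0" using xs(1) by simp
  ultimately have 3: "3 \<le> length xs" by linarith
  have "{xs ! i, xs ! (Suc i mod length xs)} \<in> insert {u, v} F" if "i < length xs" for i
  proof (cases "Suc i < length xs")
    case True
    then show ?thesis using xs(5) by simp
  next
    case False
    then have "Suc i = length xs" using that by simp
    then have "i = length xs - 1" "Suc i mod length xs = 0" by simp_all
    then have "xs ! i = v" "Suc i mod length xs = 0" using h by simp_all
    then show ?thesis using h by (simp add: insert_commute)
  qed
  then show ?thesis using 3 xs(4) by (auto simp: is_cycle_def)
qed

lemma is_cycle_mono: "is_cycle F vs \<Longrightarrow> F \<subseteq> G \<Longrightarrow> is_cycle G vs"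
  by (auto simp: is_cycle_def)

text \<open>If two positions gave the same edge, each would be the cyclic successor of the other,
  which is impossible for length at least 3.\<close>

lemma card_ge_cycle:
  assumes "is_cycle F vs" "finite F"
  shows "length vs \<le> card F"
proof -
  let ?n = "length vs"
  let ?f = "\<lambda>i. {vs ! i, vs ! (Suc i mod ?n)}"
  have n: "3 \<le> ?n" and d: "distinct vs" and e: "\<And>i. i < ?n \<Longrightarrow> ?f i \<in> F"
    using assms by (auto simp: is_cycle_def)
  have "inj_on ?f {..<?n}"
  proof (rule inj_onI)
    fix i j assume ij: "i \<in> {..<?n}" "j \<in> {..<?n}" "?f i = ?f j"
    have lt: "Suc i mod ?n < ?n" "Suc j mod ?n < ?n" using n by (auto intro: mod_less_divisor)
    have S: "Suc k mod ?n = (if Suc k = ?n then 0 else Suc k)" if "k < ?n" for k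
      using that by (simp add: mod_Suc)
    show "i = j"
    proof (rule ccontr)
      assume "i \<noteq> j"
      then have "vs ! i \<noteq> vs ! j" using d ij by (simp add: nth_eq_iff_index_eq)
      then have "vs ! i = vs ! (Suc j mod ?n)" "vs ! j = vs ! (Suc i mod ?n)"
        using ij(3) by (auto simp: doubleton_eq_iff)
      then have "i = Suc j mod ?n" "j = Suc i mod ?n"
        using d ij(1,2) lt by (simp_all add: nth_eq_iff_index_eq)
      then have eq: "i = (if Suc j = ?n then 0 else Suc j)" "j = (if Suc i = ?n then 0 else Suc i)"
        using ij(1,2) S[of i] S[of j] by simp_all
      have "i = Suc j \<or> Suc j = ?n \<and> i = 0" using eq(1) by (cases "Suc j = ?n") simp_all
      moreover have "j = Suc i \<or> Suc i = ?n \<and> j = 0" using eq(2) by (cases "Suc i = ?n") simp_all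
      ultimately show False using n by linarith
    qed
  qed
  then have "card (?f ` {..<?n}) = ?n" by (simp add: card_image)
  moreover have "?f ` {..<?n} \<subseteq> F" using e by auto
  ultimately show ?thesis using card_mono[OF assms(2)] by metis
qed

text \<open>Forests are built by edges joining different components, so that counting and the
  topology of drawings both proceed by rule induction. Reflexivity of reachability excludes u =
  v.\<close>

inductive forest :: "'a set set \<Rightarrow> bool" where
  empty: "forest {}"
| insert: "forest F \<Longrightarrow> (u, v) \<notin> (adj F)\<^sup>* \<Longrightarrow> forest (insert {u, v} F)"

text \<open>The edges may be added in any order, since one whose ends are already connected would
  close a cycle.\<close>

lemma acyclic_imp_forest:
  assumes "finite F" "\<And>e. e \<in> F \<Longrightarrow> card e = 2" "\<And>vs. \<not> is_cycle F vs"
  shows "forest F"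
  using assms
proof (induction F rule: finite_induct)
  case empty
  show ?case by (rule forest.empty)
next
  case (insert e F)
  then obtain u v where uv: "e = {u, v}" "u \<noteq> v" by (metis card_2_iff insertI1)
  have "\<not> is_cycle F vs" for vs
    using insert.prems(2)[of vs] is_cycle_mono[of F vs "insert e F"] by blast
  then have "forest F" using insert.IH insert.prems(1) by simp
  moreover have "(u, v) \<notin> (adj F)\<^sup>*"
    using reach_imp_cycle[of u v F] uv insert.hyps(2) insert.prems(2) by auto
  ultimately show ?case unfolding uv(1) by (rule forest.insert)
qed

text \<open>Greedy choice: an edge is added only if its ends are not yet connected.\<close>

lemma spanning_forest:
  assumes "finite E" "\<And>e. e \<in> E \<Longrightarrow> card e = 2"
  shows "\<exists>T\<subseteq>E. forest T \<and> (\<forall>u v. {u, v} \<in> E \<longrightarrow> (u, v) \<in> (adj T)\<^sup>*)"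
  using assms
proof (induction E rule: finite_induct)
  case empty
  then show ?case using forest.empty by auto
next
  case (insert e F)
  then obtain T where T: "T \<subseteq> F" "forest T" "\<And>u v. {u, v} \<in> F \<Longrightarrow> (u, v) \<in> (adj T)\<^sup>*"
    by auto
  obtain u v where uv: "e = {u, v}" using insert by (metis card_2_iff insertI1)
  show ?case
  proof (cases "(u, v) \<in> (adj T)\<^sup>*")
    case True
    then have "(x, y) \<in> (adj T)\<^sup>*" if "{x, y} \<in> insert e F" for x y
      using that T(3) uv reach_sym[of u v T] by (auto simp: doubleton_eq_iff)
    then show ?thesis using T by blast
  next
    case False
    have "(x, y) \<in> (adj (insert e T))\<^sup>*" if "{x, y} \<in> insert e F" for x y
    proof (cases "{x, y} = e")
      case True
      then show ?thesis by (auto simp: adj_iff)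
    next
      case False
      then show ?thesis using that T(3) reach_mono[of T "insert e T"] by blast
    qed
    moreover have "forest (insert e T)"
      unfolding uv using T(2) False by (rule forest.insert)
    moreover have "insert e T \<subseteq> insert e F" using T by blast
    ultimately show ?thesis by blast
  qed
qed

text \<open>\<open>R\<close> represents the components. A new edge merges those of its two ends, and
  one of their two representatives is dropped while the other remains.\<close>

lemma forest_representatives:
  assumes "forest T" "finite V" "V \<noteq> {}" "\<Union>T \<subseteq> V"
  shows "finite T \<and> (\<exists>R\<subseteq>V. R \<noteq> {} \<and> card R + card T = card V \<and>
           (\<forall>x\<in>V. \<exists>r\<in>R. (x, r) \<in> (adj T)\<^sup>*))"
  using assms
proof (induction rule: forest.induct)
  case empty
  then show ?case by (auto intro!: exI[of _ V])
next
  case (insert F u v)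
  then have "\<Union>F \<subseteq> V" by auto
  then obtain R where R: "finite F" "R \<subseteq> V" "card R + card F = card V"
    "\<And>x. x \<in> V \<Longrightarrow> \<exists>r\<in>R. (x, r) \<in> (adj F)\<^sup>*"
    using insert.IH[OF insert.prems(1,2)] by metis
  have uvV: "u \<in> V" "v \<in> V" using insert.prems by auto
  obtain ru rv where r: "ru \<in> R" "(u, ru) \<in> (adj F)\<^sup>*" "rv \<in> R" "(v, rv) \<in> (adj F)\<^sup>*"
    using R(4) uvV by metis
  have ne: "ru \<noteq> rv"
    using r insert.hyps(2) reach_sym[of v rv F] by (metis rtrancl_trans)
  let ?G = "insert {u, v} F"
  have mono: "(x, y) \<in> (adj ?G)\<^sup>*" if "(x, y) \<in> (adj F)\<^sup>*" for x y
    using that reach_mono[of F ?G] by blast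
  have "(v, u) \<in> (adj ?G)\<^sup>*" by (auto simp: adj_iff insert_commute)
  then have rvru: "(rv, ru) \<in> (adj ?G)\<^sup>*"
    using mono[OF r(2)] mono[OF reach_sym[OF r(4)]] by (meson rtrancl_trans)
  have "\<exists>r\<in>R - {rv}. (x, r) \<in> (adj ?G)\<^sup>*" if x: "x \<in> V" for x
  proof -
    obtain r' where r': "r' \<in> R" "(x, r') \<in> (adj F)\<^sup>*" using R(4) x by blast
    show ?thesis
    proof (cases "r' = rv")
      case True
      then have "(x, ru) \<in> (adj ?G)\<^sup>*" using mono r' rvru by (meson rtrancl_trans)
      then show ?thesis using r ne by blast
    next
      case False
      then show ?thesis using r' mono by blast
    qed
  qed
  moreover have "{u, v} \<notin> F" using insert.hyps(2) by (auto simp: adj_iff)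
  moreover have "card (R - {rv}) + 1 = card R"
    using r(3) R(2) insert.prems(1) by (metis Suc_eq_plus1 card_Suc_Diff1 finite_subset)
  ultimately show ?case using R ne r
    by (intro conjI exI[of _ "R - {rv}"]) auto
qed

lemma card_forest:
  assumes "forest T" "finite V" "V \<noteq> {}" "\<Union>T \<subseteq> V"
  shows "card T < card V"
proof -
  obtain R where "R \<subseteq> V" "R \<noteq> {}" "card R + card T = card V"
    using forest_representatives[OF assms] by blast
  moreover have "finite R" using calculation assms(2) finite_subset by blast
  ultimately show ?thesis by (metis card_gt_0_iff less_add_same_cancel2)
qed

subsection \<open>Crosscuts\<close>

text \<open>A path in K between the ends of e contains an arc, which closes e to a Jordan curve. The
  curve meets K exactly in that arc, and this gives the connectedness required by Janiszewski's
  theorem.\<close>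

lemma crosscut_closed_curve:
  fixes e :: "real \<Rightarrow> complex"
  assumes e: "arc e" and eK: "path_image e \<inter> K = {pathstart e, pathfinish e}"
    and pc: "path_component K (pathfinish e) (pathstart e)"
  obtains c where "simple_path c" "pathfinish c = pathstart c"
    "path_image e \<subseteq> path_image c" "path_image c \<subseteq> K \<union> path_image e"
    "connected (K \<inter> path_image c)"
proof -
  obtain p where p: "path p" "path_image p \<subseteq> K" "pathstart p = pathfinish e" "pathfinish p = pathstart e"
    using pc by (auto simp: path_component_def)
  have "pathfinish e \<noteq> pathstart e" using e arc_distinct_ends by metis
  then obtain q where q: "arc q" "path_image q \<subseteq> path_image p" "pathstart q = pathfinish e"
      "pathfinish q = pathstart e"
    using path_contains_arc[OF p(1,3,4)] by blast
  have qK: "path_image q \<subseteq> K" using q p by blast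
  have im: "path_image (e +++ q) = path_image e \<union> path_image q"
    using q by (simp add: path_image_join)
  have "path_image e \<inter> path_image q \<subseteq> {pathstart e, pathstart q}"
    using eK qK q by auto
  then have "simple_path (e +++ q)" using e q by (simp add: simple_path_join_loop)
  moreover have "K \<inter> path_image (e +++ q) = path_image q"
    using im eK qK q pathstart_in_path_image[of q] pathfinish_in_path_image[of q]
    by (simp add: Int_Un_distrib Int_commute) blast
  ultimately show ?thesis
    using that[of "e +++ q"] im qK q by (auto simp: connected_arc_image)
qed

text \<open>Neither K nor the Jordan curve separates a from b, and their intersection is connected,
  so by Janiszewski's theorem their union does not separate them either. A crosscut thus splits a
  face into at most two parts.\<close>

lemma crosscut_same_side:
  fixes e c :: "real \<Rightarrow> complex"
  assumes "compact K" "simple_path c" "pathfinish c = pathstart c"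
    "path_image e \<subseteq> path_image c" "path_image c \<subseteq> K \<union> path_image e"
    "connected (K \<inter> path_image c)" 
    and ab: "connected_component (- K) a b" "a \<notin> path_image e" "b \<notin> path_image e"
    "a \<in> inside (path_image c) \<longleftrightarrow> b \<in> inside (path_image c)"
  shows "connected_component (- (K \<union> path_image e)) a b"
proof -
  note J = Jordan_inside_outside[OF assms(2,3)] inside_no_overlap[of "path_image c"]
    outside_no_overlap[of "path_image c"] inside_Un_outside[of "path_image c"]
    inside_Int_outside[of "path_image c"]
  have "a \<notin> K" "b \<notin> K" using connected_component_in[OF ab(1)] by auto
  then have nc: "a \<notin> path_image c" "b \<notin> path_image c" using assms(5) ab by auto
  have "connected_component (- path_image c) a b"
  proof (cases "a \<in> inside (path_image c)")
    case True
    then show ?thesis using ab J unfolding connected_component_def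
      by (intro exI[of _ "inside (path_image c)"]) blast
  next
    case False
    then have "a \<in> outside (path_image c)" "b \<in> outside (path_image c)"
      using ab nc J by blast+
    then show ?thesis using J unfolding connected_component_def
      by (intro exI[of _ "outside (path_image c)"]) blast
  qed
  then have "connected_component (- (K \<union> path_image c)) a b"
    using Janiszewski[of K "path_image c" a b] assms
    by (simp add: compact_imp_closed compact_simple_path_image)
  moreover have "K \<union> path_image c = K \<union> path_image e" using assms by blast
  ultimately show ?thesis by simp
qed

text \<open>The point m is on the frontier of both the inside and the outside of the curve, so a
  ball around m that avoids K contains points of both. A crosscut thus splits the face around it
  into at least two parts.\<close>

lemma crosscut_two_sides:
  fixes e c :: "real \<Rightarrow> complex"
  assumes "closed K" "simple_path c" "pathfinish c = pathstart c"
    "path_image e \<subseteq> path_image c" "path_image c \<subseteq> K \<union> path_image e"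
    and m: "m \<in> path_image e" "m \<notin> K"
  obtains x y where "connected_component (- K) m x" "connected_component (- K) m y"
    "x \<notin> path_image e" "y \<notin> path_image e"
    "\<not> connected_component (- (K \<union> path_image e)) x y"
proof -
  note J = Jordan_inside_outside[OF assms(2,3)] inside_no_overlap[of "path_image c"]
    outside_no_overlap[of "path_image c"] inside_Un_outside[of "path_image c"]
    inside_Int_outside[of "path_image c"]
  have "open (- K)" using assms(1) by (rule open_Compl)
  then obtain r where r: "r > 0" "ball m r \<subseteq> - K" using m openE by (metis ComplI)
  have "m \<in> frontier (inside (path_image c))" "m \<in> frontier (outside (path_image c))"
    using J m assms(4) by auto
  then have "m \<in> closure (inside (path_image c))" "m \<in> closure (outside (path_image c))"
    by (auto simp: frontier_def)
  then obtain x y where x: "x \<in> inside (path_image c)" "dist x m < r"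
      and y: "y \<in> outside (path_image c)" "dist y m < r"
    using r(1) by (meson closure_approachable)
  have "connected_component (- K) m x" "connected_component (- K) m y"
    unfolding connected_component_def
    using r x y by (auto intro!: exI[of _ "ball m r"] simp: dist_commute)
  moreover have "x \<notin> path_image e"
    using x(1) assms(4) inside_no_overlap[of "path_image c"] by blast
  moreover have "y \<notin> path_image e"
    using y(1) assms(4) outside_no_overlap[of "path_image c"] by blast
  moreover have "\<not> connected_component (- (K \<union> path_image e)) x y"
  proof
    assume "connected_component (- (K \<union> path_image e)) x y"
    then have "connected_component (- path_image c) x y"
      using assms(5) connected_component_of_subset
      by (metis Compl_anti_mono)
    then have "y \<in> inside (path_image c)" using x inside_same_component by metis
    then show False using y(1) inside_Int_outside[of "path_image c"] by blast
  qed
  ultimately show ?thesis using that by blast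
qed

subsection \<open>Faces of plane graphs\<close>

locale plane_graph = finite_simple_graph V E for V :: "'a set" and E +
  fixes pos :: "'a \<Rightarrow> complex" and \<gamma> :: "'a set \<Rightarrow> real \<Rightarrow> complex"
  assumes drawing: "plane_drawing V E pos \<gamma>"
begin

lemma inj_pos: "inj_on pos V"
  using drawing by (simp add: plane_drawing_def)

lemma arc_edge: "e \<in> E \<Longrightarrow> arc (\<gamma> e)"
  using drawing by (simp add: plane_drawing_def)

lemma edge_ends: "e \<in> E \<Longrightarrow> {pathstart (\<gamma> e), pathfinish (\<gamma> e)} = pos ` e"
  using drawing by (simp add: plane_drawing_def)

lemma edge_Int_vertices: "e \<in> E \<Longrightarrow> path_image (\<gamma> e) \<inter> pos ` V = pos ` e"
  using drawing by (simp add: plane_drawing_def)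

lemma edge_Int_edge:
  assumes "e \<in> E" "f \<in> E" "e \<noteq> f"
  shows "path_image (\<gamma> e) \<inter> path_image (\<gamma> f) \<subseteq> pos ` (e \<inter> f)"
proof -
  have "path_image (\<gamma> e) \<inter> path_image (\<gamma> f) \<subseteq> pos ` V"
    using drawing assms by (simp add: plane_drawing_def)
  then have "path_image (\<gamma> e) \<inter> path_image (\<gamma> f) \<subseteq> pos ` e \<inter> pos ` f"
    using edge_Int_vertices assms by blast
  also have "\<dots> = pos ` (e \<inter> f)"
    using inj_on_image_Int[OF inj_pos] edge_subset assms by metis
  finally show ?thesis .
qed

text \<open>All vertices are drawn whatever \<open>F\<close> is, so a new edge meets the drawing
  exactly in its two ends.\<close>

definition drawn :: "'a set set \<Rightarrow> complex set" where
  "drawn F = pos ` V \<union> (\<Union>e\<in>F. path_image (\<gamma> e))"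

lemma drawn_mono: "F \<subseteq> G \<Longrightarrow> drawn F \<subseteq> drawn G"
  by (auto simp: drawn_def)

lemma connected_component_drawn_mono:
  "connected_component (- drawn G) a b \<Longrightarrow> F \<subseteq> G \<Longrightarrow> connected_component (- drawn F) a b"
  using connected_component_of_subset[of "- drawn G" a b "- drawn F"] drawn_mono by blast

lemma drawn_insert: "drawn (insert e F) = drawn F \<union> path_image (\<gamma> e)"
  by (auto simp: drawn_def)

lemma compact_drawn:
  assumes "F \<subseteq> E"
  shows "compact (drawn F)"
  unfolding drawn_def
  using assms finite_V finite_subset[OF assms finite_E] arc_edge
  by (intro compact_Un[OF finite_imp_compact compact_UN]) (auto intro: compact_arc_image)

lemma edge_Int_drawn:
  assumes "F \<subseteq> E" "e \<in> E" "e \<notin> F"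
  shows "path_image (\<gamma> e) \<inter> drawn F = pos ` e"
proof
  have "path_image (\<gamma> e) \<inter> path_image (\<gamma> f) \<subseteq> pos ` e" if "f \<in> F" for f
    using edge_Int_edge[of e f] that assms by blast
  then show "path_image (\<gamma> e) \<inter> drawn F \<subseteq> pos ` e"
    using edge_Int_vertices assms(2) unfolding drawn_def by blast
  show "pos ` e \<subseteq> path_image (\<gamma> e) \<inter> drawn F"
    using edge_Int_vertices assms(2) unfolding drawn_def by blast
qed

text \<open>An arc without its ends is connected; hence the interior of a new edge lies in a single
  face.\<close>

lemma edge_interior_connected:
  assumes "F \<subseteq> E" "e \<in> E" "e \<notin> F"
  shows "connected (path_image (\<gamma> e) - drawn F)"
proof -
  have "path_image (\<gamma> e) - drawn F = path_image (\<gamma> e) - pos ` e"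
    using edge_Int_drawn[OF assms] by blast
  then show ?thesis
    using edge_ends[OF assms(2)] arc_edge[OF assms(2)]
    by (metis arc_imp_simple_path connected_simple_path_endless)
qed

lemma pos_in_drawn: "v \<in> V \<Longrightarrow> pos v \<in> drawn F"
  by (simp add: drawn_def)

lemma reach_imp_path_component:
  assumes "F \<subseteq> E" "u \<in> V" "(u, v) \<in> (adj F)\<^sup>*"
  shows "path_component (drawn F) (pos u) (pos v)"
  using assms(3)
proof (induction rule: rtrancl_induct)
  case base
  show ?case using pos_in_drawn[OF assms(2)] by (simp add: path_component_refl)
next
  case (step x y)
  then have e: "{x, y} \<in> F" "{x, y} \<in> E" using assms by (auto simp: adj_iff)
  have "path_image (\<gamma> {x, y}) \<subseteq> drawn F" using e by (auto simp: drawn_def)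
  moreover have "path_component (path_image (\<gamma> {x, y})) (pos x) (pos y)"
  proof -
    have "path_connected (path_image (\<gamma> {x, y}))"
      using arc_edge[OF e(2)] by (simp add: arc_imp_path path_connected_path_image)
    moreover have "pos x \<in> path_image (\<gamma> {x, y})" "pos y \<in> path_image (\<gamma> {x, y})"
      using edge_Int_vertices[OF e(2)] by blast+
    ultimately show ?thesis by (simp add: path_connected_component)
  qed
  ultimately have "path_component (drawn F) (pos x) (pos y)"
    using path_component_of_subset by metis
  then show ?case using step.IH path_component_trans by metis
qed

lemma edge_closed_curve:
  assumes F: "F \<subseteq> E" and uv: "{u, v} \<in> E" "{u, v} \<notin> F" "(u, v) \<in> (adj F)\<^sup>*"
  obtains c where "simple_path c" "pathfinish c = pathstart c"
    "path_image (\<gamma> {u, v}) \<subseteq> path_image c"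
    "path_image c \<subseteq> drawn F \<union> path_image (\<gamma> {u, v})"
    "connected (drawn F \<inter> path_image c)"
proof -
  let ?e = "\<gamma> {u, v}"
  have V: "u \<in> V" "v \<in> V" using edge_subset[OF uv(1)] by auto
  have ends: "{pathstart ?e, pathfinish ?e} = {pos u, pos v}"
    using edge_ends[OF uv(1)] by simp
  \<comment> \<open>Both directions are recorded because the arc may start at either end of the
    edge.\<close>
  have "path_component (drawn F) (pos u) (pos v)" "path_component (drawn F) (pos v) (pos u)"
    using reach_imp_path_component[OF F V(1) uv(3)] path_component_sym by metis+
  then have "path_component (drawn F) (pathfinish ?e) (pathstart ?e)"
    using ends by (auto simp: doubleton_eq_iff)
  then show ?thesis
    using crosscut_closed_curve[OF arc_edge[OF uv(1)], of "drawn F"] that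
      edge_Int_drawn[OF F uv(1,2)] edge_ends[OF uv(1)] by metis
qed

text \<open>Janiszewski's theorem applies twice because the arc of the bridge meets the part of the
  drawing reachable from \<open>u\<close>, and then the remaining part, in a single point.\<close>

lemma bridge_not_separating:
  assumes F: "F \<subseteq> E" and uv: "{u, v} \<in> E" "(u, v) \<notin> (adj F)\<^sup>*"
    and ab: "connected_component (- drawn F) a b"
      "a \<notin> path_image (\<gamma> {u, v})" "b \<notin> path_image (\<gamma> {u, v})"
  shows "connected_component (- (drawn F \<union> path_image (\<gamma> {u, v}))) a b"
proof -
  let ?e = "{u, v}"
  define C where "C = {x. (u, x) \<in> (adj F)\<^sup>*}"
  define D1 where "D1 = {e\<in>F. e \<subseteq> C}"
  define D2 where "D2 = {e\<in>F. e \<inter> C = {}}"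
  define K1 where "K1 = pos ` (V \<inter> C) \<union> (\<Union>e\<in>D1. path_image (\<gamma> e))"
  define K2 where "K2 = pos ` (V - C) \<union> (\<Union>e\<in>D2. path_image (\<gamma> e))"
  have V: "u \<in> V" "v \<in> V" using edge_subset[OF uv(1)] by auto
  have C: "u \<in> C" "v \<notin> C" using uv(2) by (auto simp: C_def)
  have notF: "?e \<notin> F" using uv(2) by (auto simp: adj_iff)
  have DE: "D1 \<subseteq> E" "D2 \<subseteq> E" using F by (auto simp: D1_def D2_def)
  \<comment> \<open>\<open>C\<close> is closed under adjacency in \<open>F\<close>, so no edge of
    \<open>F\<close> leaves it.\<close>
  have "F = D1 \<union> D2"
  proof -
    have "e \<subseteq> C \<or> e \<inter> C = {}" if e: "e \<in> F" for e
    proof -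
      obtain x y where xy: "e = {x, y}" using card_edge e F by (metis card_2_iff subsetD)
      have "(x, y) \<in> adj F" "(y, x) \<in> adj F" using e xy by (auto simp: adj_iff insert_commute)
      then have "x \<in> C \<longleftrightarrow> y \<in> C" by (auto simp: C_def intro: rtrancl_into_rtrancl)
      then show ?thesis using xy by auto
    qed
    then show ?thesis by (auto simp: D1_def D2_def)
  qed
  then have K: "drawn F = K1 \<union> K2" by (auto simp: drawn_def K1_def K2_def)
  have posin: "pos x \<in> path_image (\<gamma> e) \<Longrightarrow> x \<in> V \<Longrightarrow> e \<in> E \<Longrightarrow> x \<in> e" for x e
    using edge_Int_vertices[of e] inj_pos edge_subset[of e]
    by (metis IntI image_eqI inj_on_image_mem_iff)
  have compact: "compact K1" "compact K2"
    unfolding K1_def K2_def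
    using finite_V finite_subset[OF DE(1) finite_E] finite_subset[OF DE(2) finite_E] arc_edge DE
    by (intro compact_Un[OF finite_imp_compact compact_UN]; auto intro: compact_arc_image)+
  have disj: "K1 \<inter> K2 = {}"
  proof (rule ccontr)
    assume "K1 \<inter> K2 \<noteq> {}"
    then obtain p where p: "p \<in> K1" "p \<in> K2" by blast
    have p1: "(\<exists>x\<in>V \<inter> C. p = pos x) \<or> (\<exists>e\<in>D1. p \<in> path_image (\<gamma> e))"
      and p2: "(\<exists>x\<in>V - C. p = pos x) \<or> (\<exists>e\<in>D2. p \<in> path_image (\<gamma> e))"
      using p unfolding K1_def K2_def by blast+
    have inj: "x = y" if "pos x = pos y" "x \<in> V" "y \<in> V" for x y
      using that inj_pos by (auto dest: inj_onD)
    have ee: False if "e \<in> D1" "f \<in> D2" "p \<in> path_image (\<gamma> e)" "p \<in> path_image (\<gamma> f)" for e f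
    proof -
      have ef: "e \<in> E" "f \<in> E" "e \<inter> f = {}"
        using that(1,2) F by (auto simp: D1_def D2_def)
      have "e \<noteq> f" using ef card_edge[of e] by auto
      then show False using edge_Int_edge[of e f] ef that(3,4) by auto
    qed
    from p1 p2 show False
    proof (elim disjE bexE)
      fix x y assume "x \<in> V \<inter> C" "y \<in> V - C" "p = pos x" "p = pos y"
      then show False using inj[of x y] by simp
    next
      fix x f assume "x \<in> V \<inter> C" "f \<in> D2" "p = pos x" "p \<in> path_image (\<gamma> f)"
      then show False using posin[of x f] F by (auto simp: D2_def)
    next
      fix f x assume "f \<in> D1" "x \<in> V - C" "p = pos x" "p \<in> path_image (\<gamma> f)"
      then show False using posin[of x f] F by (auto simp: D1_def)
    qed (use ee in blast)
  qed
  have "path_image (\<gamma> ?e) \<inter> (K1 \<union> K2) = {pos u, pos v}"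
    using edge_Int_drawn[OF F uv(1) notF] K by simp
  moreover have "pos u \<in> K1" "pos v \<in> K2" using V C by (auto simp: K1_def K2_def)
  ultimately have I: "K1 \<inter> path_image (\<gamma> ?e) = {pos u}" "K2 \<inter> path_image (\<gamma> ?e) = {pos v}"
    using disj by blast+
  have e: "connected_component (- path_image (\<gamma> ?e)) a b"
    using connected_arc_complement[OF arc_edge[OF uv(1)]] ab
    by (simp add: connected_component_eq_UNIV connected_iff_connected_component)
  have ab12: "connected_component (- K1) a b" "connected_component (- K2) a b"
    using ab(1) K connected_component_of_subset by (metis Compl_anti_mono Un_upper1 Un_upper2)+
  have closed_e: "closed (path_image (\<gamma> ?e))"
    using arc_edge[OF uv(1)] by (simp add: closed_arc_image)
  have 1: "connected_component (- (K1 \<union> path_image (\<gamma> ?e))) a b"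
    using Janiszewski[OF compact(1) closed_e _ ab12(1) e] I by simp
  have "(K1 \<union> path_image (\<gamma> ?e)) \<inter> K2 = {pos v}" using I disj by blast
  then have "connected_component (- ((K1 \<union> path_image (\<gamma> ?e)) \<union> K2)) a b"
    using Janiszewski[OF _ compact_imp_closed[OF compact(2)] _ 1 ab12(2)] compact(1)
      arc_edge[OF uv(1)] by (simp add: compact_Un compact_arc_image)
  moreover have "(K1 \<union> path_image (\<gamma> ?e)) \<union> K2 = drawn F \<union> path_image (\<gamma> ?e)"
    using K by blast
  ultimately show ?thesis by simp
qed

text \<open>A finite set of points does not separate the plane, and every edge of a forest is a
  bridge at the moment it is added.\<close>

lemma forest_not_separating:
  assumes "forest F" "F \<subseteq> E"
  shows "connected (- drawn F)"
  using assms
proof (induction rule: forest.induct)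
  case empty
  have "connected (UNIV - pos ` V)"
    using finite_V by (intro connected_open_delete_finite) auto
  then show ?case by (simp add: drawn_def Compl_eq_Diff_UNIV)
next
  case (insert F u v)
  then have F: "F \<subseteq> E" "{u, v} \<in> E" "connected (- drawn F)" by auto
  then show ?case
    using bridge_not_separating[OF F(1,2) insert.hyps(2)]
    unfolding drawn_insert connected_iff_connected_component by auto
qed

lemma edge_interior_nonempty:
  assumes "e \<in> E"
  shows "\<exists>m. m \<in> path_image (\<gamma> e) - pos ` e"
proof -
  have "infinite (path_image (\<gamma> e))"
    using arc_edge[OF assms] unfolding path_image_def arc_def
    by (simp add: finite_image_iff)
  moreover have "finite (pos ` e)" using card_edge[OF assms] card.infinite by force
  ultimately show ?thesis by (metis finite_Diff2 finite.emptyI ex_in_conv)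
qed

text \<open>The faces of a drawing are represented by finite sets of points, one in each face.\<close>

definition separated :: "complex set \<Rightarrow> complex set \<Rightarrow> bool" where
  "separated K A \<longleftrightarrow> finite A \<and> A \<inter> K = {} \<and>
     (\<forall>x\<in>A. \<forall>y\<in>A. connected_component (- K) x y \<longrightarrow> x = y)"

text \<open>Each edge outside the spanning set T has its ends already connected when it is added. It
  therefore closes a Jordan curve and cuts the face containing its interior, which yields one more
  face per edge.\<close>

lemma many_faces:
  assumes T: "T \<subseteq> E" and spanning: "\<And>u v. {u, v} \<in> E \<Longrightarrow> (u, v) \<in> (adj T)\<^sup>*"
    and G: "finite G" "G \<subseteq> E - T"
  shows "\<exists>A. separated (drawn (T \<union> G)) A \<and> card A = Suc (card G)"
  using G
proof (induction G rule: finite_induct)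
  case empty
  have "drawn T \<noteq> UNIV" using compact_drawn[OF T] not_compact_UNIV by metis
  then obtain a where "a \<notin> drawn T" by blast
  then show ?case by (intro exI[of _ "{a}"]) (auto simp: separated_def)
next
  case (insert e G)
  then obtain A where A: "separated (drawn (T \<union> G)) A" "card A = Suc (card G)" by auto
  let ?F = "T \<union> G" and ?K = "drawn (T \<union> G)"
  have e: "e \<in> E" "e \<notin> ?F" and F: "?F \<subseteq> E" using insert T by auto
  obtain u v where uv: "e = {u, v}" using card_edge[OF e(1)] by (metis card_2_iff)
  have "(u, v) \<in> (adj ?F)\<^sup>*" using spanning e uv reach_mono[of T ?F] by blast
  then obtain c where c: "simple_path c" "pathfinish c = pathstart c"
    "path_image (\<gamma> e) \<subseteq> path_image c" "path_image c \<subseteq> ?K \<union> path_image (\<gamma> e)"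
    using edge_closed_curve[OF F, of u v] e uv by metis
  obtain m where m: "m \<in> path_image (\<gamma> e)" "m \<notin> ?K"
    using edge_interior_nonempty[OF e(1)] edge_Int_drawn[OF F e] by blast
  obtain x y where xy: "connected_component (- ?K) m x" "connected_component (- ?K) m y"
    "x \<notin> path_image (\<gamma> e)" "y \<notin> path_image (\<gamma> e)"
    "\<not> connected_component (- (?K \<union> path_image (\<gamma> e))) x y"
    using crosscut_two_sides[OF compact_imp_closed[OF compact_drawn[OF F]] c m] by blast
  define U where "U = connected_component_set (- ?K) m"
  define B where "B = insert x (insert y (A - U))"
  \<comment> \<open>The interior of the edge stays in \<open>U\<close>, so representatives of other
    faces are not hit by it.\<close>
  have U_e: "path_image (\<gamma> e) - ?K \<subseteq> U"
    using edge_interior_connected[OF F e] m unfolding U_def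
    by (intro connected_component_maximal) auto
  have fin: "finite A" using A by (simp add: separated_def)
  have K': "drawn (T \<union> insert e G) = ?K \<union> path_image (\<gamma> e)"
    using drawn_insert[of e ?F] by simp
  have xyU: "x \<in> U" "y \<in> U" using xy by (auto simp: U_def)
  have "x \<noteq> y"
  proof
    assume "x = y"
    moreover have "x \<notin> ?K" using xy(1) connected_component_in by blast
    ultimately show False using xy(3,5) by (simp add: connected_component_refl)
  qed
  have "card (A \<inter> U) \<le> 1"
  proof -
    have "a = b" if "a \<in> A \<inter> U" "b \<in> A \<inter> U" for a b
    proof -
      have "connected_component (- ?K) a b"
        using that connected_component_sym connected_component_trans unfolding U_def
          Int_iff mem_Collect_eq by metis
      then show ?thesis using that A(1) by (auto simp: separated_def)
    qed
    then show ?thesis using fin by (simp add: card_le_Suc0_iff_eq)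
  qed
  moreover have "card A = card (A \<inter> U) + card (A - U)"
    using fin by (metis card_Int_Diff)
  moreover have "card B = Suc (Suc (card (A - U)))"
    using fin xyU \<open>x \<noteq> y\<close> unfolding B_def by auto
  ultimately have "Suc (card (insert e G)) \<le> card B" using A(2) insert.hyps by simp
  moreover have "separated (drawn (T \<union> insert e G)) B"
    unfolding separated_def
  proof (intro conjI ballI impI)
    show "finite B" using fin by (simp add: B_def)
    show "B \<inter> drawn (T \<union> insert e G) = {}"
      using A(1) xy(1-4) U_e connected_component_in[of "- ?K" m] unfolding K' B_def separated_def
      by blast
    fix a b assume ab: "a \<in> B" "b \<in> B" "connected_component (- drawn (T \<union> insert e G)) a b"
    then have cc: "connected_component (- ?K) a b"
      using connected_component_drawn_mono[of "T \<union> insert e G" a b ?F] by blast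
    then have "a \<in> U \<longleftrightarrow> b \<in> U" unfolding U_def mem_Collect_eq
      using connected_component_sym connected_component_trans by metis
    then consider "a \<in> A" "b \<in> A" | "a \<in> {x, y}" "b \<in> {x, y}"
      using ab(1,2) xyU unfolding B_def by blast
    then show "a = b"
    proof cases
      case 1
      then show ?thesis using A(1) cc by (simp add: separated_def)
    next
      case 2
      then show ?thesis using xy(5) ab(3) connected_component_sym unfolding K' by blast
    qed
  qed
  \<comment> \<open>If A has no point in \<open>U\<close>, then \<open>B\<close> is one larger than
    wanted and is trimmed.\<close>
  ultimately obtain B' where "B' \<subseteq> B" "card B' = Suc (card (insert e G))"
    "separated (drawn (T \<union> insert e G)) B"
    using obtain_subset_with_card_n by metis
  then show ?case
    by (intro exI[of _ B']) (auto simp: separated_def intro: finite_subset)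
qed

text \<open>Only edge interiors count: a vertex on the frontier may also be the end of edges that do
  not border the face.\<close>

definition boundary :: "complex \<Rightarrow> 'a set set" where
  "boundary a = {e\<in>E. frontier (connected_component_set (- drawn E) a) \<inter>
     (path_image (\<gamma> e) - pos ` V) \<noteq> {}}"

text \<open>Otherwise the boundary edges form a forest, whose drawing has a connected complement.
  This complement meets the face but not its frontier, so it lies inside the bounded face, although
  the drawing itself is bounded too.\<close>

lemma boundary_has_cycle:
  assumes a: "a \<notin> drawn E" and bdd: "bounded (connected_component_set (- drawn E) a)"
  shows "\<exists>vs. is_cycle (boundary a) vs"
proof (rule ccontr)
  assume "\<not> ?thesis"
  moreover have B: "boundary a \<subseteq> E" by (auto simp: boundary_def)
  ultimately have "forest (boundary a)"
    using acyclic_imp_forest finite_subset[OF B finite_E] card_edge by blast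
  then have conn: "connected (- drawn (boundary a))"
    using forest_not_separating B by blast
  let ?f = "connected_component_set (- drawn E) a"
  have op: "open (- drawn E)" using compact_drawn by (simp add: compact_imp_closed open_Compl)
  have "frontier ?f \<subseteq> drawn E"
    using frontier_of_connected_component_subset[of "- drawn E" a] op
      compact_imp_closed[OF compact_drawn[of E]]
    by (metis frontier_complement frontier_subset_closed order_refl order_trans)
  then have fr: "frontier ?f \<subseteq> drawn (boundary a)"
    unfolding drawn_def boundary_def by blast
  have "?f \<subseteq> - drawn E" by (rule connected_component_subset)
  then have "?f \<inter> - drawn (boundary a) \<noteq> {}"
    using drawn_mono[OF B] a connected_component_refl_eq[of "- drawn E" a] by blast
  then have "- drawn (boundary a) \<subseteq> ?f"
    using connected_Int_frontier[OF conn, of ?f] fr by blast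
  then have "bounded (- drawn (boundary a))" using bdd bounded_subset by blast
  moreover have "bounded (drawn (boundary a))" using compact_drawn[OF B] by (rule compact_imp_bounded)
  ultimately have "bounded (UNIV :: complex set)"
    by (metis Compl_partition2 bounded_Un)
  then show False using not_bounded_UNIV by blast
qed

text \<open>Without e, all faces bordering e merge into the one containing its interior. Restoring e
  splits that face by a Jordan curve into at most two, or not at all if e is a bridge.\<close>

lemma edge_on_two_boundaries:
  assumes e: "e \<in> E" and A: "separated (drawn E) A"
  shows "card {a\<in>A. e \<in> boundary a} \<le> 2"
proof -
  let ?F = "E - {e}" and ?P = "path_image (\<gamma> e)"
  let ?K = "drawn ?F"
  have F: "?F \<subseteq> E" "e \<notin> ?F" by auto
  have K: "drawn E = ?K \<union> ?P" using drawn_insert[of e ?F] e by (simp add: insert_absorb)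
  have fin: "finite A" using A by (simp add: separated_def)
  obtain u v where uv: "e = {u, v}" using card_edge[OF e] by (metis card_2_iff)
  have PK: "?P - ?K = ?P - pos ` V"
    using edge_Int_drawn[OF F(1) e F(2)] edge_Int_vertices[OF e] by blast
  have conP: "connected (?P - ?K)" using edge_interior_connected[OF F(1) e F(2)] .
  have opK: "open (- ?K)" using compact_drawn[OF F(1)] by (simp add: compact_imp_closed open_Compl)
  \<comment> \<open>A small ball around a frontier point inside the edge avoids the rest of the
    drawing and meets the face of a.\<close>
  have touch: "\<exists>m\<in>?P - ?K. connected_component (- ?K) a m" if a: "a \<in> A" "e \<in> boundary a" for a
  proof -
    let ?f = "connected_component_set (- drawn E) a"
    obtain m where m: "m \<in> frontier ?f" "m \<in> ?P - ?K"
      using a PK by (auto simp: boundary_def)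
    then have "m \<in> - ?K" by blast
    then obtain r where r: "r > 0" "ball m r \<subseteq> - ?K" using openE[OF opK] by blast
    have "m \<in> closure ?f" using m(1) by (simp add: frontier_def)
    then obtain z where z: "z \<in> ?f" "dist z m < r"
      using r(1) unfolding closure_approachable by blast
    have "connected_component (- ?K) a z"
      using z(1) connected_component_drawn_mono[of E a z ?F] by blast
    moreover have "connected_component (- ?K) z m"
      unfolding connected_component_def using r z(2)
      by (intro exI[of _ "ball m r"]) (auto simp: dist_commute)
    ultimately show ?thesis using m(2) connected_component_trans by metis
  qed
  have cc: "connected_component (- ?K) a b"
    if ab: "a \<in> A" "e \<in> boundary a" "b \<in> A" "e \<in> boundary b" for a b
  proof -
    obtain m n where mn: "m \<in> ?P - ?K" "connected_component (- ?K) a m"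
        "n \<in> ?P - ?K" "connected_component (- ?K) b n"
      using touch ab by metis
    have "connected_component (- ?K) m n"
      using conP mn unfolding connected_component_def by (intro exI[of _ "?P - ?K"]) auto
    then show ?thesis using mn connected_component_sym connected_component_trans by metis
  qed
  have notP: "a \<notin> ?P" if "a \<in> A" for a using A that K by (auto simp: separated_def)
  have sepD: "a = b" if "a \<in> A" "b \<in> A" "connected_component (- (?K \<union> ?P)) a b" for a b
    using A that K by (simp add: separated_def)
  show ?thesis
  proof (cases "(u, v) \<in> (adj ?F)\<^sup>*")
    case True
    then obtain c where c: "simple_path c" "pathfinish c = pathstart c"
      "?P \<subseteq> path_image c" "path_image c \<subseteq> ?K \<union> ?P" "connected (?K \<inter> path_image c)"
      using edge_closed_curve[OF F(1), of u v] e uv by auto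
    let ?s = "\<lambda>a. a \<in> inside (path_image c)"
    have "inj_on ?s {a\<in>A. e \<in> boundary a}"
      using crosscut_same_side[OF compact_drawn[OF F(1)] c] cc notP sepD
      by (intro inj_onI) blast
    then have "card {a\<in>A. e \<in> boundary a} \<le> card (UNIV :: bool set)"
      by (intro card_inj_on_le) auto
    then show ?thesis by simp
  next
    case False
    have "a = b" if "a \<in> {a\<in>A. e \<in> boundary a}" "b \<in> {a\<in>A. e \<in> boundary a}" for a b
      using bridge_not_separating[OF F(1), of u v a b] False cc[of a b] notP sepD that e uv by blast
    then have "card {a\<in>A. e \<in> boundary a} \<le> Suc 0"
      using fin by (intro card_le_Suc0_iff_eq[THEN iffD2]) auto
    then show ?thesis by simp
  qed
qed

text \<open>The bound k (|E| - |V| + 1) \<le> 2 |E|, written without subtraction. Incidences of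
  edges with bounded faces are counted twice: a bounded face has at least k boundary edges, an edge
  borders at most two faces.\<close>

lemma edge_bound:
  assumes "V \<noteq> {}" and girth: "\<And>vs. is_cycle E vs \<Longrightarrow> k \<le> length vs"
  shows "k * (card E + 1) \<le> 2 * card E + k * card V"
proof -
  obtain T where T: "T \<subseteq> E" "forest T" "\<And>u v. {u, v} \<in> E \<Longrightarrow> (u, v) \<in> (adj T)\<^sup>*"
    using spanning_forest[OF finite_E card_edge] by blast
  have cT: "card T < card V"
    using T edge_subset by (intro card_forest[OF T(2) finite_V assms(1)]) blast
  obtain A where A: "separated (drawn E) A" "card A = Suc (card (E - T))"
    using many_faces[OF T(1) T(3), of "E - T"] finite_E T(1)
    by (auto simp: Un_absorb1)
  have fin: "finite A" using A by (simp add: separated_def)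
  let ?f = "\<lambda>a. connected_component_set (- drawn E) a"
  define A' where "A' = {a\<in>A. bounded (?f a)}"
  \<comment> \<open>The complement of a compact set in the plane has only one unbounded
    component.\<close>
  have "a = b" if ab: "a \<in> A - A'" "b \<in> A - A'" for a b
  proof -
    have "?f a \<in> components (- drawn E)" "?f b \<in> components (- drawn E)"
      using A(1) ab by (auto simp: separated_def components_def)
    moreover have "bounded (- (- drawn E))"
      using compact_drawn[of E] by (simp add: compact_imp_bounded)
    ultimately have "?f a = ?f b"
      using cobounded_unique_unbounded_component[of "- drawn E"] ab
      by (simp add: A'_def)
    moreover have "b \<in> ?f b" using A(1) ab by (auto simp: separated_def connected_component_refl_eq)
    ultimately have "connected_component (- drawn E) a b" by blast
    then show ?thesis using A(1) ab by (simp add: separated_def)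
  qed
  then have "card (A - A') \<le> Suc 0"
    using fin by (intro card_le_Suc0_iff_eq[THEN iffD2]) auto
  moreover have "card A = card A' + card (A - A')"
    using fin by (metis (no_types, lifting) A'_def card_Diff_subset card_mono finite_subset
        le_add_diff_inverse mem_Collect_eq subsetI)
  ultimately have A'E: "card (E - T) \<le> card A'" using A(2) by simp
  have "k \<le> card (boundary a)" if a: "a \<in> A'" for a
  proof -
    obtain vs where vs: "is_cycle (boundary a) vs"
      using boundary_has_cycle[of a] a A(1) by (auto simp: A'_def separated_def)
    have B: "boundary a \<subseteq> E" by (auto simp: boundary_def)
    then show ?thesis
      using girth[OF is_cycle_mono[OF vs B]] card_ge_cycle[OF vs] finite_subset[OF B finite_E]
      by linarith
  qed
  then have "k * card A' \<le> (\<Sum>a\<in>A'. card (boundary a))"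
    using sum_bounded_below[of A' k "\<lambda>a. card (boundary a)"] by (simp add: mult.commute)
  also have "\<dots> = (\<Sum>e\<in>E. card {a\<in>A'. e \<in> boundary a})"
  proof -
    have "(\<Sum>a\<in>A'. card (boundary a)) = (\<Sum>a\<in>A'. card {e\<in>E. e \<in> boundary a})"
      by (intro sum.cong arg_cong[where f = card]) (auto simp: boundary_def)
    also have "\<dots> = (\<Sum>e\<in>E. card {a\<in>A'. e \<in> boundary a})"
      using fin finite_E by (intro sum_multicount_gen) (auto simp: A'_def)
    finally show ?thesis .
  qed
  also have "\<dots> \<le> (\<Sum>e\<in>E. 2)"
  proof (rule sum_mono)
    fix e assume "e \<in> E"
    then have "card {a\<in>A. e \<in> boundary a} \<le> 2" using edge_on_two_boundaries A(1) by blast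
    moreover have "card {a\<in>A'. e \<in> boundary a} \<le> card {a\<in>A. e \<in> boundary a}"
      using fin by (intro card_mono) (auto simp: A'_def)
    ultimately show "card {a\<in>A'. e \<in> boundary a} \<le> 2" by linarith
  qed
  finally have "k * card A' \<le> 2 * card E" by simp
  \<comment> \<open>This combines |A'| \<ge> |E| - |T| with |T| \<le> |V| - 1.\<close>
  moreover have "card E + 1 \<le> card A' + card V"
    using A'E cT T(1) finite_E card_Diff_subset[of T E] finite_subset[of T E] card_mono[of E T]
    by linarith
  then have "k * (card E + 1) \<le> k * card A' + k * card V"
    by (metis distrib_left mult_le_mono2)
  ultimately show ?thesis by linarith
qed

end

section \<open>Restriction of drawings and the bound for planar graphs\<close>

lemma plane_drawing_induced:
  assumes "plane_drawing V E pos \<gamma>" "W \<subseteq> V"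
  shows "plane_drawing W {e\<in>E. e \<subseteq> W} pos \<gamma>"
  unfolding plane_drawing_def
proof (intro conjI ballI impI)
  let ?F = "{e\<in>E. e \<subseteq> W}"
  show "inj_on pos W" using assms by (auto simp: plane_drawing_def intro: inj_on_subset)
  fix e assume e: "e \<in> ?F"
  have P: "path_image (\<gamma> e) \<inter> pos ` V = pos ` e" using assms(1) e by (simp add: plane_drawing_def)
  show "arc (\<gamma> e)" "{pathstart (\<gamma> e), pathfinish (\<gamma> e)} = pos ` e"
    using assms(1) e by (auto simp: plane_drawing_def)
  show "path_image (\<gamma> e) \<inter> pos ` W = pos ` e" using P e assms(2) by blast
  fix f assume "f \<in> ?F" "e \<noteq> f"
  then have "path_image (\<gamma> e) \<inter> path_image (\<gamma> f) \<subseteq> pos ` V"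
    using assms(1) e by (simp add: plane_drawing_def)
  \<comment> \<open>Vertex points on the arc of e are ends of e and hence belong to W.\<close>
  then show "path_image (\<gamma> e) \<inter> path_image (\<gamma> f) \<subseteq> pos ` W" using P e by blast
qed

lemma girth_le_length: "is_cycle E vs \<Longrightarrow> girth E \<le> enat (length vs)"
  unfolding girth_def by (rule INF_lower) simp

theorem corollary3p10:
  fixes V :: "'a set" and E :: "'a set set" and g :: nat
  assumes "g \<ge> 1"
    and "simple_graph V E"
    and "planar_graph V E"
    and "girth E \<ge> enat (8 * g)"
  shows "circular_chromatic_number V E \<le> 2 + 1 / real g"
proof -
  obtain pos \<gamma> where drawing: "plane_drawing V E pos \<gamma>"
    using assms(3) by (auto simp: planar_graph_def)
  have girth: "8 * g \<le> length vs" if "is_cycle E vs" for vs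
    using order_trans[OF assms(4) girth_le_length[OF that]] by simp
  have sparse: "(4 * g - 1) * card {e\<in>E. e \<subseteq> W} < 4 * g * card W" if W: "W \<subseteq> V" "W \<noteq> {}" for W
  proof -
    let ?F = "{e\<in>E. e \<subseteq> W}"
    interpret plane_graph W ?F pos \<gamma>
      using simple_graph_induced[OF assms(2) W(1)] plane_drawing_induced[OF drawing W(1)]
      by unfold_locales
    have "8 * g * (card ?F + 1) \<le> 2 * card ?F + 8 * g * card W"
      using W(2) girth is_cycle_mono[of ?F _ E] by (intro edge_bound) auto
    then have "4 * g * card ?F + 4 * g \<le> card ?F + 4 * g * card W"
      by (simp add: algebra_simps)
    \<comment> \<open>This makes the truncated subtraction in (4g - 1) |F| = 4g |F| - |F|
      exact.\<close>
    moreover have "card ?F \<le> 4 * g * card ?F" using assms(1) by simp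
    ultimately show ?thesis using assms(1) unfolding diff_mult_distrib by linarith
  qed
  obtain h where "cycle_hom (2 * int g + 1) E h"
    using sparse_imp_cycle_hom[OF assms(1,2) girth sparse] by blast
  then obtain c where "circular_colouring V E (2 * g + 1) g c"
    using cycle_hom_imp_circular_colouring assms(1,2) by blast
  then have "real (2 * g + 1) / real g \<in> circular_ratios V E"
    using assms(1) unfolding circular_ratios_def
    by (intro CollectI exI[of _ "2 * g + 1"] exI[of _ g]) auto
  then have "circular_chromatic_number V E \<le> real (2 * g + 1) / real g"
    unfolding circular_chromatic_number_def by (rule cInf_lower[OF _ bdd_below_circular_ratios])
  also have "\<dots> = 2 + 1 / real g" using assms(1) by (simp add: field_simps)
  finally show ?thesis .
qed

end
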